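(* Consider the single-server $k$-class scheduling problem on $\mathcal S=\mathbb Z_+^k$ with arrival rates $\lambda_i$, service rates $\mu_i>0$, finite action set $\{\mu_ie_i\}_{i=1}^k$, a state-only cost $c(x)\ge0$, and stability condition $\rho=\sum_i\lambda_i/\mu_i<1$. Let $F(x)=\{i:x_i>0\}$ be the set of nonempty classes and $n(x)=|F(x)|$; the reference kernel $r_{t,x}$ is uniform over the feasible actions, i.e. it places mass $1/n(x)$ on each $\mu_ie_i$ with $i\in F(x)$, and at $x=0$ the server idles. Let $\mathcal U=\mathrm{conv}\{\mu_ie_i\}_{i\in[k]}$ be the (state-independent) convex hull of the pure schedules. Assume: (1) there is $\kappa_V<\infty$ with $\sup_{u\in\mathcal U}\big\{\sum_i\lambda_i(1+V(x+e_i))+\sum_{i:x_i>0}u_i(1+V(x-e_i))\big\}\le\kappa_V(1+V(x))$ for all $x$; (2) there exist $h:\mathcal S\to\mathbb R$ with $\|h\|_V<\infty$ and $g^*\in\mathbb R$ such that, with a pointwise maximizer $u^{**}(x)\in\arg\max_{u\in\mathcal U}\{\mathcal G^uh(x)-c(x)\}$, one has $g^*+\mathcal G^{u^{**}}h(x)=c(x)$ for all $x$; (3) $c(x)\to\infty$ as $|x|\to\infty$; $-h$ is bounded below with finite sublevel sets; the process generated by $u^{**}$ is irreducible; and its unique invariant probability measure $\tilde\pi^*$ satisfies $\langle V,\tilde\pi^*\rangle<\infty$. Suppose $f^\varepsilon\in\mathcal F^{\mathrm{soft}}$ attains the supremum of $\langle f_T-f_0,\tilde\pi^*\rangle$ over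 the soft-feasible class $\mathcal F^{\mathrm{soft}}$. Then, for every $\varepsilon>0$ and $T>0$, $$0\ \le\ \langle f^\varepsilon_T-f^\varepsilon_0,\tilde\pi^*\rangle-g^*T\ \le\ T\,\varepsilon\,\mathbb E_{\tilde\pi^*}[\log n(X)]\ \le\ T\,\varepsilon\log k,$$ where $X\sim\tilde\pi^*$ and, by convention, $\log n(0):=0$ (so that the gap between the hard and soft Hamiltonians is zero at $x=0$).
   Context: Notation. $e_i$ are the unit vectors of $\mathbb Z^k$ and $[k]=\{1,\dots,k\}$; for $f$ on $[0,T]\times\mathcal S$ write $f_+^i(t,x)=f(t,x+e_i)-f(t,x)$, and $f_-^i(t,x)=f(t,x-e_i)-f(t,x)$ for $x_i>0$. The generator of the queue under action $u$ is $$\mathcal G^uf(x)=\sum_{i=1}^k\big\{\lambda_i[f(x+e_i)-f(x)]+u_i[f(x-e_i)-f(x)]\mathbf 1_{x_i>0}\big\}.$$ Convex-hull convention: for hypotheses (1)-(3) the action set is, at every state, $\mathcal U=\mathrm{conv}\{\mu_ie_i\}_{i\in[k]}$, whose vertices are the pure schedules and whose other points are randomized schedules; effort assigned to an empty class has no effect, because of the indicator in $\mathcal G^u$. For a map $u^{**}:\mathcal S\to\mathcal U$, $\mathcal G^{u^{**}}f(x)=\mathcal G^{u^{**}(x)}f(x)$, and the process it generates is the Markov jump process with this generator. Standing stability assumption: $V:\mathcal S\to[0,\infty)$ has finite sublevel sets, and there are $W:\mathcal S\to[1,\infty)$, a finite set $C\subset\mathcal S$ and $b<\infty$ such that every admissible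 stationary control $\mu:\mathcal S\to\mathcal U$ generates an irreducible process with $\mathcal G^\mu V\le-W+b\mathbf 1_C$ (the admissible controls being restricted to those stabilized through this common $V$); and $0\le c\le W$. $\|\phi\|_V=\sup_x|\phi(x)|/(1+V(x))$; $\langle\phi,\nu\rangle=\int\phi\,d\nu$; $f_t=f(t,\cdot)$. Soft and hard Hamiltonians, with control-independent terms omitted, for $x\ne0$: $$H^\varepsilon f(t,x)=\varepsilon\log\Big(\frac1{n(x)}\sum_{i\in F(x)}e^{\mu_if_-^i(t,x)/\varepsilon}\Big),\qquad Hf(t,x)=\max_{i\in F(x)}\mu_if_-^i(t,x),$$ and both are $0$ at $x=0$; thus $f$ is never evaluated outside $\mathbb Z_+^k$. With the control-independent terms restored, the soft Hamiltonian is $\mathcal H^\varepsilon f(t,x)=\sum_i\lambda_if_+^i(t,x)-c(x)+H^\varepsilon f(t,x)$. Soft-feasible class: $\mathcal F^{\mathrm{soft}}$ is the set of $f:[0,T]\times\mathcal S\to\mathbb R$ with $f(\cdot,x)\in C^1$ for each $x$, $\sup_t\|f(t,\cdot)\|_V+\sup_t\|\partial_tf(t,\cdot)\|_V<\infty$, and $\partial_tf+\mathcal H^\varepsilon f\le0$ on $[0,T]\times\mathcal S$. (Existence and uniqueness of $\tilde\pi^*$ in (3) follow from the other hypotheses.) *)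

theory Defs
  imports "HOL-Probability.Probability"
begin

text \<open>
  The \<open>k\<close> classes are the elements of a finite type \<open>'k\<close>, so \<open>k = CARD('k)\<close>. The state space is
  \<open>nat ^ 'k\<close>; arrival rates, service rates and actions are vectors in \<open>real ^ 'k\<close>.
\<close>

type_synonym 'k state = "nat ^ 'k"

abbreviation unit_state :: "'k::finite \<Rightarrow> 'k state" where
  "unit_state i \<equiv> axis i 1"

definition nonempty_classes :: "'k::finite state \<Rightarrow> 'k set" where
  "nonempty_classes x = {i. x $ i > 0}"

definition num_nonempty :: "'k::finite state \<Rightarrow> nat" where
  "num_nonempty x = card (nonempty_classes x)"

definition log_num_nonempty :: "'k::finite state \<Rightarrow> real" where
  "log_num_nonempty x = (if x = 0 then 0 else ln (real (num_nonempty x)))"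

definition action_hull :: "real ^ 'k::finite \<Rightarrow> (real ^ 'k) set" where
  "action_hull \<mu> = convex hull (range (\<lambda>i. axis i (\<mu> $ i)))"

definition diff_up :: "'k::finite \<Rightarrow> ('k state \<Rightarrow> real) \<Rightarrow> 'k state \<Rightarrow> real" where
  "diff_up i f x = f (x + unit_state i) - f x"

text \<open>Subtraction on \<^typ>\<open>nat\<close> truncates, so \<open>diff_down i f x\<close> is used only where \<open>x $ i > 0\<close>.\<close>

definition diff_down :: "'k::finite \<Rightarrow> ('k state \<Rightarrow> real) \<Rightarrow> 'k state \<Rightarrow> real" where
  "diff_down i f x = f (x - unit_state i) - f x"

definition generator ::
  "real ^ 'k::finite \<Rightarrow> real ^ 'k \<Rightarrow> ('k state \<Rightarrow> real) \<Rightarrow> 'k state \<Rightarrow> real" where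
  "generator lam u f x =
     (\<Sum>i\<in>UNIV. lam $ i * diff_up i f x + (if x $ i > 0 then u $ i * diff_down i f x else 0))"

definition control_generator ::
  "real ^ 'k::finite \<Rightarrow> ('k state \<Rightarrow> real ^ 'k) \<Rightarrow> ('k state \<Rightarrow> real) \<Rightarrow> 'k state \<Rightarrow> real" where
  "control_generator lam m f x = generator lam (m x) f x"

text \<open>
  Transition function \<open>P\<^sub>t(x, y) = (exp (t G) 1\<^sub>y)(x)\<close> of the Markov jump process with generator \<open>G\<close>,
  as the pointwise exponential series. It is used for \<open>G = control_generator lam m\<close> with \<open>m\<close>
  taking values in \<open>action_hull \<mu>\<close>: then the jump rates are bounded uniformly in the state,
  \<open>G\<close> is a bounded operator on the bounded functions, and the process with generator \<open>G\<close> is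
  non-explosive with transition semigroup \<open>exp (t G)\<close>.
\<close>

definition transition_prob ::
  "(('s \<Rightarrow> real) \<Rightarrow> 's \<Rightarrow> real) \<Rightarrow> real \<Rightarrow> 's \<Rightarrow> 's \<Rightarrow> real" where
  "transition_prob G t x y = (\<Sum>n. t ^ n / fact n * (G ^^ n) (indicator {y}) x)"

definition irreducible_process :: "(('s \<Rightarrow> real) \<Rightarrow> 's \<Rightarrow> real) \<Rightarrow> bool" where
  "irreducible_process G \<longleftrightarrow> (\<forall>x y. \<exists>t\<ge>0. transition_prob G t x y > 0)"

text \<open>The state space is countable, so probability measures on it are \<^type>\<open>pmf\<close>s.\<close>

definition invariant_distribution :: "(('s \<Rightarrow> real) \<Rightarrow> 's \<Rightarrow> real) \<Rightarrow> 's pmf \<Rightarrow> bool" where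
  "invariant_distribution G p \<longleftrightarrow>
     (\<forall>t\<ge>0. \<forall>y. measure_pmf.expectation p (\<lambda>x. transition_prob G t x y) = pmf p y)"

definition norm_V :: "('s \<Rightarrow> real) \<Rightarrow> ('s \<Rightarrow> real) \<Rightarrow> ennreal" where
  "norm_V V \<phi> = (SUP x. ennreal (\<bar>\<phi> x\<bar> / (1 + V x)))"

definition soft_H :: "real ^ 'k::finite \<Rightarrow> real \<Rightarrow> ('k state \<Rightarrow> real) \<Rightarrow> 'k state \<Rightarrow> real" where
  "soft_H \<mu> \<epsilon> f x =
     (if x = 0 then 0
      else \<epsilon> * ln (1 / real (num_nonempty x) *
                   (\<Sum>i\<in>nonempty_classes x. exp (\<mu> $ i * diff_down i f x / \<epsilon>))))"

definition soft_Hamiltonian ::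
  "real ^ 'k::finite \<Rightarrow> real ^ 'k \<Rightarrow> ('k state \<Rightarrow> real) \<Rightarrow> real
     \<Rightarrow> ('k state \<Rightarrow> real) \<Rightarrow> 'k state \<Rightarrow> real" where
  "soft_Hamiltonian lam \<mu> c \<epsilon> f x =
     (\<Sum>i\<in>UNIV. lam $ i * diff_up i f x) - c x + soft_H \<mu> \<epsilon> f x"

text \<open>
  A function on \<open>[0, T] \<times> S\<close> is a function on all of \<open>real\<close> in its first argument, of which only
  the values on \<open>{0..T}\<close> matter; the time derivatives at \<open>0\<close> and \<open>T\<close> are one-sided.
\<close>

definition soft_feasible ::
  "real ^ 'k::finite \<Rightarrow> real ^ 'k \<Rightarrow> ('k state \<Rightarrow> real) \<Rightarrow> ('k state \<Rightarrow> real) \<Rightarrow> real \<Rightarrow> real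
     \<Rightarrow> (real \<Rightarrow> 'k state \<Rightarrow> real) set" where
  "soft_feasible lam \<mu> c V \<epsilon> T =
     {f. \<exists>f'.
        (\<forall>x. continuous_on {0..T} (\<lambda>t. f' t x)) \<and>
        (\<forall>x. \<forall>t\<in>{0..T}. ((\<lambda>s. f s x) has_real_derivative f' t x) (at t within {0..T})) \<and>
        (SUP t\<in>{0..T}. norm_V V (f t)) + (SUP t\<in>{0..T}. norm_V V (f' t)) < \<infinity> \<and>
        (\<forall>t\<in>{0..T}. \<forall>x. f' t x + soft_Hamiltonian lam \<mu> c \<epsilon> (f t) x \<le> 0)}"

definition increment_pairing :: "'s pmf \<Rightarrow> real \<Rightarrow> (real \<Rightarrow> 's \<Rightarrow> real) \<Rightarrow> real" where
  "increment_pairing p T f = measure_pmf.expectation p (\<lambda>x. f T x - f 0 x)"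

end

theory Submission imports Defs
begin

text \<open>
  The lower bound comes from a competitor: \<open>h x + g t\<close> is soft-feasible, because the normalized
  log-sum-exp is below the maximum over the nonempty classes, and that maximum is below the value
  which \<open>u_opt\<close> attains in the optimality equation (\<open>affine_soft_feasible\<close>).

  For the upper bound, differentiate the expectation of \<open>f t\<close> under \<open>p\<close>. An invariant distribution
  annihilates the generator on all functions bounded by a multiple of \<open>1 + V\<close>
  (\<open>invariant_distribution_dominated\<close>). Hence the expectation of the cost is \<open>g\<close>, and feasibility
  bounds the derivative by \<open>g\<close> plus the expectation of the gap between the service part of the
  generator of \<open>u_opt\<close> and the soft Hamiltonian. Log-sum-exp is at least the maximum minus
  \<open>\<epsilon> log n\<close>, so the gap is at most \<open>\<epsilon> log n\<close> (\<open>soft_increment_le\<close>), provided that \<open>u_opt\<close> spends all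
  its effort on nonempty classes.

  This proviso is the difficulty: \<open>u_opt\<close> maximizes over all schedules and can idle by serving an
  empty class, while the Hamiltonians maximize over the nonempty classes only. Idling is excluded
  because the supremum is attained (\<open>attained_supremum_imp_no_idling\<close>). Call a function balanced if
  serving any nonempty class at its full rate changes it at the same speed. On balanced functions
  all work-conserving policies have one common linear generator, and balancedness is preserved by
  its semigroup. Starting from the Laplace transform of the total remaining work, subtract the
  semigroup run backwards in time from \<open>f\<close>: the soft Hamiltonian is shifted exactly, so the result
  is still feasible. The pairing increases by the integrated expectation of the idle fraction times
  the rate at which work-conserving service raises the evolved transform. This rate is nonnegative,
  and for the transform itself it is positive at all nonempty states. Since \<open>f\<close> is optimal, the idle
  fraction vanishes at every nonempty state in the support of \<open>p\<close>.
\<close>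

section \<open>Functions dominated by a Lyapunov function\<close>

definition dominated :: "('s \<Rightarrow> real) \<Rightarrow> ('s \<Rightarrow> real) \<Rightarrow> bool" where
  "dominated V \<phi> \<longleftrightarrow> (\<exists>C. \<forall>x. \<bar>\<phi> x\<bar> \<le> C * (1 + V x))"

lemma norm_V_le_iff:
  assumes V: "\<And>x. V x \<ge> 0" and "C \<ge> 0"
  shows "norm_V V \<phi> \<le> ennreal C \<longleftrightarrow> (\<forall>x. \<bar>\<phi> x\<bar> \<le> C * (1 + V x))"
proof -
  have "\<bar>\<phi> x\<bar> / (1 + V x) \<le> C \<longleftrightarrow> \<bar>\<phi> x\<bar> \<le> C * (1 + V x)" for x
    using V[of x] by (simp add: pos_divide_le_eq)
  then show ?thesis
    using \<open>C \<ge> 0\<close> by (simp add: norm_V_def SUP_le_iff)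
qed

lemma SUP_norm_V_finite_iff:
  assumes V: "\<And>x. V x \<ge> 0"
  shows "(SUP t\<in>I. norm_V V (f t)) < \<infinity> \<longleftrightarrow> (\<exists>C\<ge>0. \<forall>t\<in>I. \<forall>x. \<bar>f t x\<bar> \<le> C * (1 + V x))"
proof -
  have "(SUP t\<in>I. norm_V V (f t)) < \<infinity> \<longleftrightarrow> (\<exists>C\<ge>0. (SUP t\<in>I. norm_V V (f t)) \<le> ennreal C)"
  proof
    assume fin: "(SUP t\<in>I. norm_V V (f t)) < \<infinity>"
    show "\<exists>C\<ge>0. (SUP t\<in>I. norm_V V (f t)) \<le> ennreal C"
      using fin by (intro exI[of _ "enn2real (SUP t\<in>I. norm_V V (f t))"]) auto
  next
    assume "\<exists>C\<ge>0. (SUP t\<in>I. norm_V V (f t)) \<le> ennreal C"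
    then show "(SUP t\<in>I. norm_V V (f t)) < \<infinity>"
      by (auto intro: le_less_trans)
  qed
  then show ?thesis
    by (simp add: SUP_le_iff norm_V_le_iff[OF V] cong: conj_cong)
qed

lemma dominated_iff_norm_V:
  assumes V: "\<And>x. V x \<ge> 0"
  shows "dominated V \<phi> \<longleftrightarrow> norm_V V \<phi> < \<infinity>"
proof -
  have "norm_V V \<phi> < \<infinity> \<longleftrightarrow> (\<exists>C\<ge>0. \<forall>x. \<bar>\<phi> x\<bar> \<le> C * (1 + V x))"
    using SUP_norm_V_finite_iff[OF V, where I="{()}" and f="\<lambda>_. \<phi>"] by simp
  moreover have "C \<ge> 0" if "\<forall>x. \<bar>\<phi> x\<bar> \<le> C * (1 + V x)" for C
  proof -
    have "0 \<le> C * (1 + V undefined)"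
      by (rule order_trans[OF abs_ge_zero that[rule_format]])
    then show ?thesis
      using V[of undefined] by (simp add: zero_le_mult_iff)
  qed
  ultimately show ?thesis
    unfolding dominated_def by blast
qed

lemma dominatedI: "(\<And>x. \<bar>\<phi> x\<bar> \<le> C * (1 + V x)) \<Longrightarrow> dominated V \<phi>"
  by (auto simp: dominated_def)

lemma dominated_bounded:
  assumes "\<And>x. V x \<ge> 0" "\<And>x. \<bar>\<phi> x\<bar> \<le> a"
  shows "dominated V \<phi>"
proof (rule dominatedI)
  fix x
  have "0 \<le> a"
    using assms(2)[of x] by linarith
  then show "\<bar>\<phi> x\<bar> \<le> a * (1 + V x)"
    using assms(1)[of x] assms(2)[of x] by (simp add: distrib_left add_increasing2)
qed

lemma dominated_integrable:
  assumes "integrable (measure_pmf p) V" "dominated V \<phi>"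
  shows "integrable (measure_pmf p) \<phi>"
proof -
  obtain C where C: "\<And>x. \<bar>\<phi> x\<bar> \<le> C * (1 + V x)"
    using assms(2) by (auto simp: dominated_def)
  show ?thesis
  proof (rule Bochner_Integration.integrable_bound)
    show "integrable (measure_pmf p) (\<lambda>x. C * (1 + V x))"
      using assms(1) by simp
    show "AE x in measure_pmf p. norm (\<phi> x) \<le> norm (C * (1 + V x))"
      by (rule AE_I2) (use C in \<open>simp only: real_norm_def, rule order_trans[OF _ abs_ge_self]\<close>)
  qed simp
qed

text \<open>
  Differentiation under the expectation. By the mean value inequality the difference quotients are
  bounded by the bound on the derivatives, so dominated convergence applies. The derivative is
  taken within the interval, which gives one-sided derivatives at the end points.
\<close>

lemma expectation_has_real_derivative:
  fixes F F' :: "real \<Rightarrow> 's \<Rightarrow> real"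
  assumes der: "\<And>t x. t \<in> {0..T} \<Longrightarrow> ((\<lambda>s. F s x) has_real_derivative F' t x) (at t within {0..T})"
    and bound: "\<And>t x. t \<in> {0..T} \<Longrightarrow> \<bar>F' t x\<bar> \<le> w x"
    and w: "integrable (measure_pmf p) w"
    and F: "\<And>t. t \<in> {0..T} \<Longrightarrow> integrable (measure_pmf p) (F t)"
    and t: "t \<in> {0..T}"
  shows "((\<lambda>s. measure_pmf.expectation p (F s)) has_real_derivative
           measure_pmf.expectation p (F' t)) (at t within {0..T})"
  unfolding has_field_derivative_iff tendsto_at_iff_sequentially
proof (intro allI impI)
  fix X :: "nat \<Rightarrow> real"
  assume X: "\<forall>i. X i \<in> {0..T} - {t}" and lim: "X \<longlonglongrightarrow> t"
  have "(\<lambda>n. measure_pmf.expectation p (\<lambda>x. (F (X n) x - F t x) / (X n - t)))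
          \<longlonglongrightarrow> measure_pmf.expectation p (F' t)"
  proof (rule integral_dominated_convergence[where w=w])
    show "AE x in measure_pmf p. (\<lambda>n. (F (X n) x - F t x) / (X n - t)) \<longlonglongrightarrow> F' t x"
    proof (rule AE_I2)
      fix x
      show "(\<lambda>n. (F (X n) x - F t x) / (X n - t)) \<longlonglongrightarrow> F' t x"
        using der[OF t, of x] X lim
        unfolding has_field_derivative_iff tendsto_at_iff_sequentially by (auto simp: comp_def)
    qed
    show "AE x in measure_pmf p. norm ((F (X n) x - F t x) / (X n - t)) \<le> w x" for n
    proof (rule AE_I2)
      fix x
      have "norm (F (X n) x - F t x) \<le> w x * norm (X n - t)"
        by (rule field_differentiable_bound[where S="{0..T}" and f'="\<lambda>t. F' t x"])
          (use der bound t X in auto)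
      moreover have "X n \<noteq> t"
        using X by auto
      ultimately show "norm ((F (X n) x - F t x) / (X n - t)) \<le> w x"
        by (simp add: norm_divide pos_divide_le_eq)
    qed
  qed (use w in auto)
  moreover have "measure_pmf.expectation p (\<lambda>x. (F (X n) x - F t x) / (X n - t)) =
    (measure_pmf.expectation p (F (X n)) - measure_pmf.expectation p (F t)) / (X n - t)" for n
    using X F[OF t] F[of "X n"] by simp
  ultimately show "((\<lambda>y. (measure_pmf.expectation p (F y) - measure_pmf.expectation p (F t)) / (y - t)) \<circ> X)
      \<longlonglongrightarrow> measure_pmf.expectation p (F' t)"
    by (simp only: comp_def)
qed

section \<open>Exponential series of bounded operators\<close>

definition operator_bound :: "(('s \<Rightarrow> real) \<Rightarrow> 's \<Rightarrow> real) \<Rightarrow> real \<Rightarrow> bool" where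
  "operator_bound A K \<longleftrightarrow> K \<ge> 0 \<and> (\<forall>\<psi> a. (\<forall>x. \<bar>\<psi> x\<bar> \<le> a) \<longrightarrow> (\<forall>x. \<bar>A \<psi> x\<bar> \<le> K * a))"

definition exp_series :: "(('s \<Rightarrow> real) \<Rightarrow> 's \<Rightarrow> real) \<Rightarrow> real \<Rightarrow> ('s \<Rightarrow> real) \<Rightarrow> 's \<Rightarrow> real" where
  "exp_series A t \<psi> x = (\<Sum>n. t ^ n / fact n * (A ^^ n) \<psi> x)"

lemma transition_prob_eq_exp_series: "transition_prob G t x y = exp_series G t (indicator {y}) x"
  by (simp add: transition_prob_def exp_series_def)

lemma exp_series_0: "exp_series A 0 \<psi> = \<psi>"
proof
  fix x
  have "(\<lambda>n. 0 ^ n / fact n * (A ^^ n) \<psi> x) sums (0 ^ 0 / fact 0 * (A ^^ 0) \<psi> x)"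
    using sums_finite[of "{0}" "\<lambda>n. 0 ^ n / fact n * (A ^^ n) \<psi> x"] by simp
  then show "exp_series A 0 \<psi> x = \<psi> x"
    by (simp add: exp_series_def sums_iff)
qed

lemma exp_sums: "(\<lambda>n. t ^ n / fact n) sums exp (t::real)"
  using exp_converges[of t] by (simp add: scaleR_conv_of_real divide_inverse mult.commute)

context
  fixes A :: "('s \<Rightarrow> real) \<Rightarrow> 's \<Rightarrow> real" and K a :: real and \<psi> :: "'s \<Rightarrow> real"
  assumes bound: "operator_bound A K" and \<psi>: "\<And>x. \<bar>\<psi> x\<bar> \<le> a"
begin

lemma iterate_bound: "\<bar>(A ^^ n) \<psi> x\<bar> \<le> K ^ n * a"
proof (induction n arbitrary: x)
  case 0
  then show ?case using \<psi> by simp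
next
  case (Suc n)
  then show ?case using bound by (auto simp: operator_bound_def mult.assoc)
qed

lemma exp_series_term_bound:
  "norm (t ^ n / fact n * (A ^^ n) \<psi> x) \<le> a * ((\<bar>t\<bar> * K) ^ n / fact n)"
proof -
  have "norm (t ^ n / fact n * (A ^^ n) \<psi> x) = \<bar>t\<bar> ^ n / fact n * \<bar>(A ^^ n) \<psi> x\<bar>"
    by (simp add: abs_mult power_abs)
  also have "\<dots> \<le> \<bar>t\<bar> ^ n / fact n * (K ^ n * a)"
    by (intro mult_left_mono iterate_bound) auto
  finally show ?thesis
    by (simp add: power_mult_distrib mult_ac)
qed

lemma exp_series_summable: "summable (\<lambda>n. t ^ n / fact n * (A ^^ n) \<psi> x)"
  by (rule summable_comparison_test'[OF _ exp_series_term_bound])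
    (intro summable_mult sums_summable[OF exp_sums])

lemma exp_series_sums: "(\<lambda>n. t ^ n / fact n * (A ^^ n) \<psi> x) sums exp_series A t \<psi> x"
  unfolding exp_series_def by (rule summable_sums[OF exp_series_summable])

lemma exp_series_bound: "\<bar>exp_series A t \<psi> x\<bar> \<le> a * exp (\<bar>t\<bar> * K)"
  using norm_sums_le[OF exp_series_sums sums_mult[OF exp_sums] exp_series_term_bound] by simp

text \<open>
  Termwise differentiation shifts the index of the iterates, which amounts to applying \<open>A\<close> to the
  initial function first. Commuting \<open>A\<close> with the series would need continuity of \<open>A\<close> for
  pointwise limits.
\<close>

lemma exp_series_has_real_derivative:
  "((\<lambda>t. exp_series A t \<psi> x) has_real_derivative exp_series A t (A \<psi>) x) (at t)"
proof -
  define c where "c n = (A ^^ n) \<psi> x / fact n" for n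
  have "((\<lambda>t. \<Sum>n. c n * t ^ n) has_field_derivative (\<Sum>n. diffs c n * t ^ n)) (at t)"
    by (rule termdiffs_strong_converges_everywhere)
      (use exp_series_summable in \<open>simp add: c_def mult.commute\<close>)
  moreover have "diffs c n * t ^ n = t ^ n / fact n * (A ^^ n) (A \<psi>) x" for n
    by (simp add: diffs_def c_def funpow_swap1 del: of_nat_Suc)
  ultimately show ?thesis
    by (simp add: exp_series_def c_def mult.commute)
qed

end

section \<open>The queue under a stationary control\<close>

text \<open>
  Both conclusions are convex conditions which hold at the vertices, hence on the hull. The second one
  says that \<open>u $ i / \<mu> $ i\<close> is the share of effort given to class \<open>i\<close>.
\<close>

lemma action_hull_weights:
  fixes \<mu> u :: "real ^ 'k::finite"
  assumes \<mu>: "\<And>i. \<mu> $ i > 0" and u: "u \<in> action_hull \<mu>"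
  shows "u $ i \<ge> 0" "(\<Sum>i\<in>UNIV. u $ i / \<mu> $ i) = 1"
proof -
  define H where "H = {u :: real ^ 'k. (\<forall>i. u $ i \<ge> 0) \<and> (\<Sum>i\<in>UNIV. u $ i / \<mu> $ i) = 1}"
  have "convex H"
    unfolding convex_def H_def
    by (auto simp: add_divide_distrib sum.distrib sum_distrib_left[symmetric] simp flip: times_divide_eq_right)
  moreover have "axis i (\<mu> $ i) \<in> H" for i
  proof -
    have "(\<Sum>j\<in>UNIV. axis i (\<mu> $ i) $ j / \<mu> $ j) = (\<Sum>j\<in>UNIV. if j = i then 1 else 0)"
      using \<mu> by (intro sum.cong) (auto simp: axis_def less_imp_neq[THEN not_sym])
    then show ?thesis
      using \<mu> by (auto simp: H_def axis_def less_imp_le)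
  qed
  ultimately have "action_hull \<mu> \<subseteq> H"
    unfolding action_hull_def by (intro hull_minimal) auto
  with u show "u $ i \<ge> 0" "(\<Sum>i\<in>UNIV. u $ i / \<mu> $ i) = 1"
    by (auto simp: H_def)
qed

text \<open>
  The service effort of each class is at most its full rate, so the jump rates are bounded
  uniformly in the state.
\<close>

lemma action_hull_le:
  fixes \<mu> u :: "real ^ 'k::finite"
  assumes \<mu>: "\<And>i. \<mu> $ i > 0" and u: "u \<in> action_hull \<mu>"
  shows "u $ i \<le> \<mu> $ i"
proof -
  have "u $ i / \<mu> $ i \<le> (\<Sum>i\<in>UNIV. u $ i / \<mu> $ i)"
    using action_hull_weights[OF \<mu> u] \<mu> by (intro member_le_sum) (auto simp: less_imp_le)
  then show ?thesis
    using action_hull_weights(2)[OF \<mu> u] \<mu>[of i] by (simp add: pos_divide_le_eq)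
qed

lemma pure_schedule_in_action_hull: "axis i (\<mu> $ i) \<in> action_hull \<mu>"
  unfolding action_hull_def by (rule hull_inc) auto

lemma generator_eq:
  "generator lam u f x =
    (\<Sum>i\<in>UNIV. lam $ i * diff_up i f x) + (\<Sum>i\<in>nonempty_classes x. u $ i * diff_down i f x)"
  by (simp add: generator_def sum.distrib nonempty_classes_def sum.If_cases)

lemma abs_diff_up_le:
  assumes "\<And>x. \<bar>\<phi> x\<bar> \<le> a"
  shows "\<bar>diff_up i \<phi> x\<bar> \<le> 2 * a"
  unfolding diff_up_def using assms[of x] assms[of "x + unit_state i"] by linarith

lemma abs_diff_down_le:
  assumes "\<And>x. \<bar>\<phi> x\<bar> \<le> a"
  shows "\<bar>diff_down i \<phi> x\<bar> \<le> 2 * a"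
  unfolding diff_down_def using assms[of x] assms[of "x - unit_state i"] by linarith

lemma control_generator_sum:
  assumes "finite Y"
  shows "control_generator lam m (\<lambda>x. \<Sum>y\<in>Y. a y * \<psi> y x) x = (\<Sum>y\<in>Y. a y * control_generator lam m (\<psi> y) x)"
proof -
  have "control_generator lam m (\<lambda>x. \<Sum>y\<in>Y. a y * \<psi> y x) x =
      (\<Sum>i\<in>UNIV. \<Sum>y\<in>Y. a y * (lam $ i * diff_up i (\<psi> y) x +
        (if x $ i > 0 then m x $ i * diff_down i (\<psi> y) x else 0)))"
    unfolding control_generator_def generator_def
    by (intro sum.cong refl)
      (auto simp: diff_up_def diff_down_def sum_subtractf[symmetric] sum_distrib_left sum.distrib[symmetric]
        algebra_simps intro!: sum.cong)
  also have "\<dots> = (\<Sum>y\<in>Y. a y * control_generator lam m (\<psi> y) x)"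
    unfolding control_generator_def generator_def sum_distrib_left by (rule sum.swap)
  finally show ?thesis .
qed

locale queue =
  fixes lam \<mu> :: "real ^ 'k::finite"
  assumes lam_nonneg: "\<And>i. lam $ i \<ge> 0" and \<mu>_pos: "\<And>i. \<mu> $ i > 0"
begin

definition total_rate :: real where
  "total_rate = (\<Sum>i\<in>UNIV. lam $ i) + (\<Sum>i\<in>UNIV. \<mu> $ i)"

lemma total_rate_nonneg: "total_rate \<ge> 0"
  using lam_nonneg \<mu>_pos by (auto simp: total_rate_def less_imp_le intro!: add_nonneg_nonneg sum_nonneg)

lemma control_generator_operator_bound:
  assumes m: "\<And>x. m x \<in> action_hull \<mu>"
  shows "operator_bound (control_generator lam m) (2 * total_rate)"
  unfolding operator_bound_def
proof (intro conjI allI impI)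
  fix \<psi> :: "'k state \<Rightarrow> real" and a x
  assume \<psi>: "\<forall>x. \<bar>\<psi> x\<bar> \<le> a"
  have m_nn: "m x $ i \<ge> 0" and m_le: "m x $ i \<le> \<mu> $ i" for i
    using action_hull_weights(1)[OF \<mu>_pos m] action_hull_le[OF \<mu>_pos m] by auto
  have "\<bar>control_generator lam m \<psi> x\<bar> \<le>
      (\<Sum>i\<in>UNIV. \<bar>lam $ i * diff_up i \<psi> x + (if x $ i > 0 then m x $ i * diff_down i \<psi> x else 0)\<bar>)"
    unfolding control_generator_def generator_def by (rule sum_abs)
  also have "\<dots> \<le> (\<Sum>i\<in>UNIV. lam $ i * (2 * a) + \<mu> $ i * (2 * a))"
  proof (intro sum_mono)
    fix i
    have "\<bar>lam $ i * diff_up i \<psi> x\<bar> \<le> lam $ i * (2 * a)"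
      using abs_diff_up_le[of \<psi> a i x] \<psi> lam_nonneg[of i] by (simp add: abs_mult mult_left_mono)
    moreover have "\<bar>m x $ i * diff_down i \<psi> x\<bar> \<le> \<mu> $ i * (2 * a)"
      using abs_diff_down_le[of \<psi> a i x] \<psi> m_nn[of i] m_le[of i]
      by (simp add: abs_mult mult_mono)
    ultimately show "\<bar>lam $ i * diff_up i \<psi> x + (if x $ i > 0 then m x $ i * diff_down i \<psi> x else 0)\<bar>
        \<le> lam $ i * (2 * a) + \<mu> $ i * (2 * a)"
      by (smt (verit))
  qed
  also have "\<dots> = 2 * total_rate * a"
    by (simp add: total_rate_def sum.distrib flip: sum_distrib_right) (simp add: algebra_simps)
  finally show "\<bar>control_generator lam m \<psi> x\<bar> \<le> 2 * total_rate * a" .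
qed (use total_rate_nonneg in simp)

text \<open>
  The growth condition bounds the jump terms evaluated at the neighbours of \<open>x\<close>; the terms
  evaluated at \<open>x\<close> itself cost at most the total jump rate.
\<close>

lemma control_generator_growth:
  assumes m: "m x \<in> action_hull \<mu>" and V: "\<And>x. V x \<ge> 0"
    and growth: "(\<Sum>i\<in>UNIV. lam $ i * (1 + V (x + unit_state i))) +
        (\<Sum>i | x $ i > 0. m x $ i * (1 + V (x - unit_state i))) \<le> \<kappa> * (1 + V x)"
    and \<phi>: "\<And>x. \<bar>\<phi> x\<bar> \<le> C * (1 + V x)"
  shows "\<bar>control_generator lam m \<phi> x\<bar> \<le> C * (\<kappa> + total_rate) * (1 + V x)"
proof -
  have m_nn: "m x $ i \<ge> 0" and m_le: "m x $ i \<le> \<mu> $ i" for i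
    using action_hull_weights(1)[OF \<mu>_pos m] action_hull_le[OF \<mu>_pos m] by auto
  have "0 \<le> C * (1 + V x)"
    by (rule order_trans[OF abs_ge_zero \<phi>])
  then have C: "C \<ge> 0"
    using V[of x] by (simp add: zero_le_mult_iff)
  have up: "\<bar>diff_up i \<phi> x\<bar> \<le> C * (1 + V (x + unit_state i)) + C * (1 + V x)" for i
    unfolding diff_up_def using \<phi>[of x] \<phi>[of "x + unit_state i"] by linarith
  have down: "\<bar>diff_down i \<phi> x\<bar> \<le> C * (1 + V (x - unit_state i)) + C * (1 + V x)" for i
    unfolding diff_down_def using \<phi>[of x] \<phi>[of "x - unit_state i"] by linarith
  have "\<bar>control_generator lam m \<phi> x\<bar> \<le> (\<Sum>i\<in>UNIV. \<bar>lam $ i * diff_up i \<phi> x\<bar>) +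
      (\<Sum>i\<in>nonempty_classes x. \<bar>m x $ i * diff_down i \<phi> x\<bar>)"
    unfolding control_generator_def generator_eq
    by (rule order_trans[OF abs_triangle_ineq add_mono]) (rule sum_abs)+
  also have "\<dots> \<le> (\<Sum>i\<in>UNIV. lam $ i * (C * (1 + V (x + unit_state i)) + C * (1 + V x))) +
      (\<Sum>i\<in>nonempty_classes x. m x $ i * (C * (1 + V (x - unit_state i)) + C * (1 + V x)))"
    using up down lam_nonneg m_nn by (intro add_mono sum_mono) (auto simp: abs_mult mult_left_mono)
  also have "\<dots> = C * ((\<Sum>i\<in>UNIV. lam $ i * (1 + V (x + unit_state i))) +
        (\<Sum>i | x $ i > 0. m x $ i * (1 + V (x - unit_state i)))) +
      ((\<Sum>i\<in>UNIV. lam $ i) + (\<Sum>i\<in>nonempty_classes x. m x $ i)) * (C * (1 + V x))"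
    by (simp add: nonempty_classes_def sum.distrib sum_distrib_left sum_distrib_right algebra_simps)
  also have "\<dots> \<le> C * (\<kappa> * (1 + V x)) + total_rate * (C * (1 + V x))"
  proof (intro add_mono mult_left_mono mult_right_mono growth C)
    have "(\<Sum>i\<in>nonempty_classes x. m x $ i) \<le> (\<Sum>i\<in>nonempty_classes x. \<mu> $ i)"
      by (rule sum_mono[OF m_le])
    also have "\<dots> \<le> (\<Sum>i\<in>UNIV. \<mu> $ i)"
      by (rule sum_mono2) (auto simp: \<mu>_pos less_imp_le)
    finally show "(\<Sum>i\<in>UNIV. lam $ i) + (\<Sum>i\<in>nonempty_classes x. m x $ i) \<le> total_rate"
      by (simp add: total_rate_def)
  qed (fact \<open>0 \<le> C * (1 + V x)\<close>)
  finally show ?thesis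
    by (simp add: algebra_simps)
qed

end

section \<open>Invariant distributions annihilate the generator\<close>

text \<open>
  For \<open>G\<close> bounded the expectation of \<open>exp (t G) 1\<^sub>y\<close> does not depend on \<open>t\<close>; its derivative at
  \<open>0\<close> is the expectation of \<open>G 1\<^sub>y\<close>.
\<close>

lemma invariant_distribution_indicator:
  assumes G: "operator_bound G K" and inv: "invariant_distribution G p"
  shows "measure_pmf.expectation p (G (indicator {y})) = 0"
proof -
  define F where "F t = exp_series G t (indicator {y})" for t
  define F' where "F' t = exp_series G t (G (indicator {y}))" for t
  have ind: "\<bar>indicator {y} x :: real\<bar> \<le> 1" for x
    by (simp add: indicator_def)
  have G_ind: "\<bar>G (indicator {y}) x\<bar> \<le> K * 1" for x
    using G ind by (auto simp only: operator_bound_def)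
  have K: "K \<ge> 0"
    using G by (simp add: operator_bound_def)
  have "((\<lambda>s. measure_pmf.expectation p (F s)) has_real_derivative
      measure_pmf.expectation p (F' 0)) (at 0 within {0..1})"
  proof (rule expectation_has_real_derivative[where w="\<lambda>_. K * exp K"])
    fix t x assume t: "t \<in> {0..1::real}"
    show "((\<lambda>s. F s x) has_real_derivative F' t x) (at t within {0..1})"
      unfolding F_def F'_def
      by (rule has_field_derivative_at_within[OF exp_series_has_real_derivative[OF G ind]])
    have "\<bar>F' t x\<bar> \<le> K * exp (\<bar>t\<bar> * K)"
      unfolding F'_def using exp_series_bound[OF G G_ind] by simp
    also have "\<dots> \<le> K * exp K"
      using t K by (intro mult_left_mono) (auto simp: mult_left_le_one_le)
    finally show "\<bar>F' t x\<bar> \<le> K * exp K" .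
  next
    fix t :: real
    show "integrable (measure_pmf p) (F t)"
      using exp_series_bound[OF G ind, where t=t]
      by (intro measure_pmf.integrable_const_bound[where B="exp (\<bar>t\<bar> * K)"]) (auto simp: F_def)
  qed auto
  then have "((\<lambda>s. pmf p y) has_real_derivative measure_pmf.expectation p (F' 0)) (at 0 within {0..1})"
  proof (rule has_field_derivative_transform_within[where d=1])
    show "measure_pmf.expectation p (F s) = pmf p y" if "s \<in> {0..1}" for s
      using inv that by (simp add: invariant_distribution_def transition_prob_eq_exp_series F_def)
  qed auto
  then have "measure_pmf.expectation p (F' 0) = 0"
    using vector_derivative_unique_within_closed_interval[of 0 1 0 "\<lambda>_. pmf p y" _ 0]
    by (simp add: has_real_derivative_iff_has_vector_derivative has_vector_derivative_const)
  then show ?thesis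
    by (simp add: F'_def exp_series_0)
qed

locale stationary_queue = queue lam \<mu>
  for lam \<mu> :: "real ^ 'k::finite" +
  fixes m :: "'k state \<Rightarrow> real ^ 'k" and V :: "'k state \<Rightarrow> real" and \<kappa> :: real and p :: "'k state pmf"
  assumes m: "\<And>x. m x \<in> action_hull \<mu>" and V: "\<And>x. V x \<ge> 0" "\<And>a. finite {x. V x \<le> a}"
    and growth: "\<And>x. (\<Sum>i\<in>UNIV. lam $ i * (1 + V (x + unit_state i))) +
        (\<Sum>i | x $ i > 0. m x $ i * (1 + V (x - unit_state i))) \<le> \<kappa> * (1 + V x)"
    and inv: "invariant_distribution (control_generator lam m) p"
    and int: "integrable (measure_pmf p) V"

text \<open>
  The truncations of a dominated function to the sublevel sets of \<open>V\<close> have finite support, so they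
  are combinations of indicators. The growth condition dominates their images under the
  generator by a multiple of \<open>1 + V\<close>, which is integrable.
\<close>

lemma (in stationary_queue) invariant_distribution_dominated:
  assumes \<phi>: "dominated V \<phi>"
  shows "dominated V (control_generator lam m \<phi>)"
    and "measure_pmf.expectation p (control_generator lam m \<phi>) = 0"
proof -
  obtain C where C: "\<And>x. \<bar>\<phi> x\<bar> \<le> C * (1 + V x)"
    using \<phi> by (auto simp: dominated_def)
  show "dominated V (control_generator lam m \<phi>)"
    by (rule dominatedI[OF control_generator_growth[OF m V(1) growth C]])
  define \<phi>' where "\<phi>' n x = (if V x \<le> real n then \<phi> x else 0)" for n x
  have \<phi>'_bound: "\<bar>\<phi>' n x\<bar> \<le> C * (1 + V x)" for n x
    using C[of x] order_trans[OF abs_ge_zero C[of x]] by (simp add: \<phi>'_def)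
  note G_bound = control_generator_growth[where m=m, OF m V(1) growth]
  have ind_int: "integrable (measure_pmf p) (control_generator lam m (indicator {y}))" for y
  proof -
    have "\<bar>indicator {y} x :: real\<bar> \<le> 1" for x
      by (simp add: indicator_def)
    with control_generator_operator_bound[where m=m, OF m]
    have "\<bar>control_generator lam m (indicator {y}) x\<bar> \<le> 2 * total_rate * 1" for x
      by (auto simp only: operator_bound_def)
    then show ?thesis
      by (intro measure_pmf.integrable_const_bound[where B="2 * total_rate"]) auto
  qed
  have "measure_pmf.expectation p (control_generator lam m (\<phi>' n)) = 0" for n
  proof -
    have \<phi>'_eq: "\<phi>' n = (\<lambda>x. \<Sum>y\<in>{y. V y \<le> real n}. \<phi> y * indicator {y} x)"
      by (auto simp: fun_eq_iff \<phi>'_def V(2) indicator_def if_distrib cong: if_cong)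
    have "control_generator lam m (\<phi>' n) =
        (\<lambda>x. \<Sum>y\<in>{y. V y \<le> real n}. \<phi> y * control_generator lam m (indicator {y}) x)"
      unfolding \<phi>'_eq by (rule ext) (rule control_generator_sum[OF V(2)])
    then show ?thesis
      using invariant_distribution_indicator[OF control_generator_operator_bound[where m=m, OF m] inv] ind_int
      by simp
  qed
  moreover have "(\<lambda>n. measure_pmf.expectation p (control_generator lam m (\<phi>' n)))
      \<longlonglongrightarrow> measure_pmf.expectation p (control_generator lam m \<phi>)"
  proof (rule integral_dominated_convergence[where w="\<lambda>x. C * (\<kappa> + total_rate) * (1 + V x)"])
    have lim: "(\<lambda>n. \<phi>' n x) \<longlonglongrightarrow> \<phi> x" for x
    proof (rule tendsto_eventually)
      obtain N where "V x \<le> real N"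
        using real_arch_simple by blast
      then show "\<forall>\<^sub>F n in sequentially. \<phi>' n x = \<phi> x"
        unfolding eventually_sequentially by (auto simp: \<phi>'_def intro!: exI[of _ N])
    qed
    have "(\<lambda>n. control_generator lam m (\<phi>' n) x) \<longlonglongrightarrow> control_generator lam m \<phi> x" for x
      unfolding control_generator_def generator_eq diff_up_def diff_down_def
      by (intro tendsto_intros lim)
    then show "AE x in measure_pmf p.
        (\<lambda>n. control_generator lam m (\<phi>' n) x) \<longlonglongrightarrow> control_generator lam m \<phi> x"
      by simp
    show "AE x in measure_pmf p.
        norm (control_generator lam m (\<phi>' n) x) \<le> C * (\<kappa> + total_rate) * (1 + V x)" for n
      using G_bound[OF \<phi>'_bound] by simp
  qed (use int in auto)
  ultimately show "measure_pmf.expectation p (control_generator lam m \<phi>) = 0"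
    by (simp add: LIMSEQ_const_iff)
qed

section \<open>Work-conserving service\<close>

lemma nonempty_classes_eq_empty_iff: "nonempty_classes x = {} \<longleftrightarrow> x = 0"
  by (auto simp: nonempty_classes_def vec_eq_iff)

lemma remove_add_commute:
  "x $ i > 0 \<Longrightarrow> x - unit_state i + unit_state j = x + unit_state j - unit_state i"
  for x :: "'k::finite state"
  by (auto simp: vec_eq_iff axis_def)

lemma diff_down_diff_up:
  "x $ i > 0 \<Longrightarrow> diff_down i (diff_up j \<psi>) x = diff_down i \<psi> (x + unit_state j) - diff_down i \<psi> x"
  for x :: "'k::finite state"
  by (simp add: diff_down_def diff_up_def remove_add_commute del: One_nat_def)

lemma diff_down_linear:
  "diff_down i (\<lambda>x. a * \<phi> x + b * \<psi> x) x = a * diff_down i \<phi> x + b * diff_down i \<psi> x"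
  by (simp add: diff_down_def algebra_simps)

context queue
begin

text \<open>
  The characteristic example of a balanced function is a transform of the law of the total
  remaining work: every class drains this work at unit speed.
\<close>

definition balanced :: "('k state \<Rightarrow> real) \<Rightarrow> bool" where
  "balanced \<psi> \<longleftrightarrow> (\<forall>x. \<forall>i\<in>nonempty_classes x. \<forall>j\<in>nonempty_classes x.
     \<mu> $ i * diff_down i \<psi> x = \<mu> $ j * diff_down j \<psi> x)"

text \<open>
  The rate of change under work-conserving service. For balanced functions the class that is served
  does not matter; the choice makes \<open>drain\<close> a linear operator on all functions.
\<close>

definition drain :: "('k state \<Rightarrow> real) \<Rightarrow> 'k state \<Rightarrow> real" where
  "drain \<psi> x = (if x = 0 then 0 else
     (let i = (SOME i. i \<in> nonempty_classes x) in \<mu> $ i * diff_down i \<psi> x))"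

definition busy_generator :: "('k state \<Rightarrow> real) \<Rightarrow> 'k state \<Rightarrow> real" where
  "busy_generator \<psi> x = (\<Sum>i\<in>UNIV. lam $ i * diff_up i \<psi> x) + drain \<psi> x"

lemma drain_0 [simp]: "drain \<psi> 0 = 0"
  by (simp add: drain_def)

lemma drain_eq:
  assumes "balanced \<psi>" "i \<in> nonempty_classes x"
  shows "drain \<psi> x = \<mu> $ i * diff_down i \<psi> x"
proof -
  have "x \<noteq> 0"
    using assms(2) nonempty_classes_eq_empty_iff by blast
  define j where "j = (SOME i. i \<in> nonempty_classes x)"
  have "j \<in> nonempty_classes x"
    unfolding j_def using assms(2) by (rule someI)
  then have "\<mu> $ i * diff_down i \<psi> x = \<mu> $ j * diff_down j \<psi> x"
    using assms unfolding balanced_def by blast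
  with \<open>x \<noteq> 0\<close> show ?thesis
    by (simp add: drain_def flip: j_def)
qed

text \<open>
  On balanced functions \<open>drain\<close> intertwines \<open>busy_generator\<close> with the generator of the queue
  killed on becoming empty: the service differences commute with the arrival differences, and
  the killing is the convention \<open>drain \<psi> 0 = 0\<close>.
\<close>

lemma service_busy_generator:
  assumes \<psi>: "balanced \<psi>" and i: "i \<in> nonempty_classes x"
  shows "\<mu> $ i * diff_down i (busy_generator \<psi>) x =
    (\<Sum>j\<in>UNIV. lam $ j * (drain \<psi> (x + unit_state j) - drain \<psi> x)) +
    \<mu> $ i * (drain \<psi> (x - unit_state i) - drain \<psi> x)"
proof -
  have xi: "x $ i > 0"
    using i by (simp add: nonempty_classes_def)
  have up: "\<mu> $ i * diff_down i \<psi> (x + unit_state j) = drain \<psi> (x + unit_state j)" for j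
    using drain_eq[OF \<psi>, of i "x + unit_state j"] xi by (simp add: nonempty_classes_def)
  have "diff_down i (busy_generator \<psi>) x =
      (\<Sum>j\<in>UNIV. lam $ j * diff_down i (diff_up j \<psi>) x) + (drain \<psi> (x - unit_state i) - drain \<psi> x)"
    by (simp add: busy_generator_def diff_down_def right_diff_distrib sum_subtractf)
  also have "(\<Sum>j\<in>UNIV. lam $ j * diff_down i (diff_up j \<psi>) x) =
      (\<Sum>j\<in>UNIV. lam $ j * (diff_down i \<psi> (x + unit_state j) - diff_down i \<psi> x))"
    by (simp add: diff_down_diff_up[OF xi])
  finally have "\<mu> $ i * diff_down i (busy_generator \<psi>) x =
      (\<Sum>j\<in>UNIV. lam $ j * (\<mu> $ i * diff_down i \<psi> (x + unit_state j) - \<mu> $ i * diff_down i \<psi> x)) +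
      \<mu> $ i * (drain \<psi> (x - unit_state i) - drain \<psi> x)"
    by (simp add: distrib_left sum_distrib_left right_diff_distrib mult.left_commute)
  then show ?thesis
    by (simp only: up drain_eq[OF \<psi> i, symmetric])
qed

text \<open>
  Serving one customer of class \<open>i\<close> and one of class \<open>j\<close> gives the same second difference in
  either order, which is why the service terms of \<open>busy_generator\<close> do not depend on the class.
\<close>

lemma balanced_busy_generator:
  assumes \<psi>: "balanced \<psi>"
  shows "balanced (busy_generator \<psi>)"
  unfolding balanced_def
proof (intro allI ballI)
  fix x :: "'k state" and i j :: 'k
  assume i: "i \<in> nonempty_classes x" and j: "j \<in> nonempty_classes x"
  show "\<mu> $ i * diff_down i (busy_generator \<psi>) x = \<mu> $ j * diff_down j (busy_generator \<psi>) x"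
  proof (cases "i = j")
    case False
    have "j \<in> nonempty_classes (x - unit_state i)" "i \<in> nonempty_classes (x - unit_state j)"
      using i j False by (auto simp: nonempty_classes_def axis_def)
    then have "drain \<psi> (x - unit_state i) = \<mu> $ j * diff_down j \<psi> (x - unit_state i)"
      "drain \<psi> (x - unit_state j) = \<mu> $ i * diff_down i \<psi> (x - unit_state j)"
      using \<psi> by (auto intro: drain_eq)
    moreover have "x - unit_state i - unit_state j = x - unit_state j - unit_state i"
      by (simp add: vec_eq_iff add.commute)
    ultimately have two_services:
      "drain \<psi> (x - unit_state i) = \<mu> $ j * (\<psi> (x - unit_state j - unit_state i) - \<psi> (x - unit_state i))"
      "drain \<psi> (x - unit_state j) = \<mu> $ i * (\<psi> (x - unit_state j - unit_state i) - \<psi> (x - unit_state j))"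
      by (simp_all only: diff_down_def)
    have "drain \<psi> x = \<mu> $ i * (\<psi> (x - unit_state i) - \<psi> x)"
      "drain \<psi> x = \<mu> $ j * (\<psi> (x - unit_state j) - \<psi> x)"
      using drain_eq[OF \<psi> i] drain_eq[OF \<psi> j] by (simp_all only: diff_down_def)
    with two_services have "\<mu> $ i * (drain \<psi> (x - unit_state i) - drain \<psi> x) =
        \<mu> $ j * (drain \<psi> (x - unit_state j) - drain \<psi> x)"
      by algebra
    then show ?thesis
      by (simp add: service_busy_generator[OF \<psi> i] service_busy_generator[OF \<psi> j])
  qed simp
qed

lemma balanced_linear:
  assumes "balanced \<phi>" "balanced \<psi>"
  shows "balanced (\<lambda>x. a * \<phi> x + b * \<psi> x)"
  unfolding balanced_def diff_down_linear
proof (intro allI ballI)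
  fix x :: "'k state" and i j :: 'k
  assume "i \<in> nonempty_classes x" "j \<in> nonempty_classes x"
  then have "\<mu> $ i * diff_down i \<phi> x = \<mu> $ j * diff_down j \<phi> x"
    "\<mu> $ i * diff_down i \<psi> x = \<mu> $ j * diff_down j \<psi> x"
    using assms unfolding balanced_def by blast+
  then show "\<mu> $ i * (a * diff_down i \<phi> x + b * diff_down i \<psi> x) =
      \<mu> $ j * (a * diff_down j \<phi> x + b * diff_down j \<psi> x)"
    by algebra
qed

text \<open>
  Service raises a balanced function with this property, so it decreases in the remaining work.
\<close>

definition decreasing :: "('k state \<Rightarrow> real) \<Rightarrow> bool" where
  "decreasing \<psi> \<longleftrightarrow> (\<forall>x. drain \<psi> x \<ge> 0)"

text \<open>
  Adding the total jump rate makes all coefficients nonnegative, so that monotonicity survives each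
  iterate and hence the exponential series.
\<close>

definition uniformized :: "('k state \<Rightarrow> real) \<Rightarrow> 'k state \<Rightarrow> real" where
  "uniformized \<psi> x = busy_generator \<psi> x + total_rate * \<psi> x"

lemma balanced_uniformized: "balanced \<psi> \<Longrightarrow> balanced (uniformized \<psi>)"
  using balanced_linear[OF balanced_busy_generator, of \<psi> \<psi> 1 total_rate]
  by (simp add: uniformized_def[abs_def])

text \<open>
  By the intertwining relation, \<open>drain (uniformized \<psi>)\<close> is a combination of values of \<open>drain \<psi>\<close>.
  The coefficient of \<open>drain \<psi> x\<close> is \<open>total_rate\<close> minus the rate of leaving \<open>x\<close>.
\<close>

lemma decreasing_uniformized:
  assumes \<psi>: "balanced \<psi>" "decreasing \<psi>"
  shows "decreasing (uniformized \<psi>)"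
  unfolding decreasing_def
proof
  fix x
  show "drain (uniformized \<psi>) x \<ge> 0"
  proof (cases "x = 0")
    case False
    then obtain i where i: "i \<in> nonempty_classes x"
      using nonempty_classes_eq_empty_iff by blast
    have nn: "drain \<psi> y \<ge> 0" for y
      using \<psi> by (simp add: decreasing_def)
    have "drain (uniformized \<psi>) x = \<mu> $ i * diff_down i (uniformized \<psi>) x"
      by (rule drain_eq[OF balanced_uniformized[OF \<psi>(1)] i])
    also have "\<dots> = \<mu> $ i * diff_down i (busy_generator \<psi>) x + total_rate * (\<mu> $ i * diff_down i \<psi> x)"
      by (simp add: uniformized_def diff_down_def algebra_simps)
    also have "\<dots> = (\<Sum>j\<in>UNIV. lam $ j * drain \<psi> (x + unit_state j)) + \<mu> $ i * drain \<psi> (x - unit_state i)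
        + (total_rate - (\<Sum>j\<in>UNIV. lam $ j) - \<mu> $ i) * drain \<psi> x"
      by (simp add: service_busy_generator[OF \<psi>(1) i] drain_eq[OF \<psi>(1) i, symmetric]
        right_diff_distrib sum_subtractf sum_distrib_right[symmetric])
        (simp add: algebra_simps)
    also have "\<dots> \<ge> 0"
    proof -
      have "\<mu> $ i \<le> (\<Sum>j\<in>UNIV. \<mu> $ j)"
        by (rule member_le_sum) (auto simp: \<mu>_pos less_imp_le)
      then have "total_rate - (\<Sum>j\<in>UNIV. lam $ j) - \<mu> $ i \<ge> 0"
        by (simp add: total_rate_def)
      then show ?thesis
        using nn lam_nonneg \<mu>_pos[of i]
        by (intro add_nonneg_nonneg sum_nonneg mult_nonneg_nonneg) (auto simp: less_imp_le)
    qed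
    finally show ?thesis .
  qed simp
qed

lemma busy_generator_bound:
  assumes \<psi>: "\<And>x. \<bar>\<psi> x\<bar> \<le> a"
  shows "\<bar>busy_generator \<psi> x\<bar> \<le> 2 * total_rate * a"
proof -
  have a: "a \<ge> 0"
    by (rule order_trans[OF abs_ge_zero \<psi>])
  have "\<bar>\<Sum>i\<in>UNIV. lam $ i * diff_up i \<psi> x\<bar> \<le> (\<Sum>i\<in>UNIV. lam $ i) * (2 * a)"
    unfolding sum_distrib_right using abs_diff_up_le[of \<psi> a _ x] \<psi> lam_nonneg
    by (intro order_trans[OF sum_abs] sum_mono) (simp add: abs_mult mult_left_mono)
  moreover have "\<bar>drain \<psi> x\<bar> \<le> (\<Sum>i\<in>UNIV. \<mu> $ i) * (2 * a)"
  proof -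
    have "\<bar>\<mu> $ i * diff_down i \<psi> x\<bar> \<le> (\<Sum>i\<in>UNIV. \<mu> $ i) * (2 * a)" for i
    proof -
      have "\<mu> $ i \<le> (\<Sum>i\<in>UNIV. \<mu> $ i)"
        by (rule member_le_sum) (auto simp: \<mu>_pos less_imp_le)
      then show ?thesis
        using abs_diff_down_le[of \<psi> a i x] \<psi> \<mu>_pos[of i] by (simp add: abs_mult mult_mono)
    qed
    moreover have "0 \<le> (\<Sum>i\<in>UNIV. \<mu> $ i) * (2 * a)"
      using a \<mu>_pos by (simp add: sum_nonneg less_imp_le)
    ultimately show ?thesis
      by (simp add: drain_def Let_def)
  qed
  ultimately show ?thesis
    unfolding busy_generator_def total_rate_def
    by (intro order_trans[OF abs_triangle_ineq]) (simp add: algebra_simps)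
qed

lemma uniformized_operator_bound: "operator_bound uniformized (3 * total_rate)"
  unfolding operator_bound_def
proof (intro conjI allI impI)
  fix \<psi> :: "'k state \<Rightarrow> real" and a x
  assume \<psi>: "\<forall>x. \<bar>\<psi> x\<bar> \<le> a"
  have "\<bar>total_rate * \<psi> x\<bar> \<le> total_rate * a"
    using \<psi> total_rate_nonneg by (simp add: abs_mult mult_left_mono)
  with busy_generator_bound[of \<psi> a x] \<psi>
  show "\<bar>uniformized \<psi> x\<bar> \<le> 3 * total_rate * a"
    by (simp add: uniformized_def)
qed (use total_rate_nonneg in simp)

text \<open>
  At a fixed state \<open>drain\<close> and \<open>busy_generator\<close> are finite combinations of point evaluations, so they commute
  with pointwise convergent series.
\<close>

lemma drain_sums: "(\<And>x. (\<lambda>n. a n x) sums b x) \<Longrightarrow> (\<lambda>n. drain (a n) x) sums drain b x"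
  unfolding drain_def diff_down_def Let_def
  by (cases "x = 0") (auto intro!: sums_mult sums_diff)

lemma busy_generator_sums:
  "(\<And>x. (\<lambda>n. a n x) sums b x) \<Longrightarrow> (\<lambda>n. busy_generator (a n) x) sums busy_generator b x"
  unfolding busy_generator_def diff_up_def
  by (intro sums_add sums_sum sums_mult sums_diff drain_sums)

lemma drain_scale: "drain (\<lambda>x. c * \<psi> x) x = c * drain \<psi> x"
  by (simp add: drain_def Let_def diff_down_def algebra_simps)

lemma busy_generator_scale: "busy_generator (\<lambda>x. c * \<psi> x) x = c * busy_generator \<psi> x"
  by (simp add: busy_generator_def drain_scale diff_up_def sum_distrib_left algebra_simps)

text \<open>
  The exponential of \<open>s\<close> times \<open>busy_generator\<close>. The factor undoes the shift by \<open>total_rate\<close>; the series in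
  \<open>uniformized\<close> preserves monotonicity term by term, which the one in \<open>busy_generator\<close> does not.
\<close>

definition busy_semigroup :: "real \<Rightarrow> ('k state \<Rightarrow> real) \<Rightarrow> 'k state \<Rightarrow> real" where
  "busy_semigroup s \<psi> x = exp (- total_rate * s) * exp_series uniformized s \<psi> x"

lemma busy_semigroup_0: "busy_semigroup 0 \<psi> = \<psi>"
  by (simp add: busy_semigroup_def exp_series_0 fun_eq_iff)

context
  fixes \<psi> :: "'k state \<Rightarrow> real" and a :: real
  assumes \<psi>_bound: "\<And>x. \<bar>\<psi> x\<bar> \<le> a"
begin

lemma busy_semigroup_sums:
  "(\<lambda>n. exp (- total_rate * s) * (s ^ n / fact n) * (uniformized ^^ n) \<psi> x) sums busy_semigroup s \<psi> x"
  using sums_mult[OF exp_series_sums[OF uniformized_operator_bound \<psi>_bound]]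
  by (simp add: busy_semigroup_def mult.assoc)

lemma busy_semigroup_bound:
  assumes "0 \<le> s" "s \<le> T"
  shows "\<bar>busy_semigroup s \<psi> x\<bar> \<le> a * exp (T * (3 * total_rate))"
proof -
  have a: "a \<ge> 0"
    by (rule order_trans[OF abs_ge_zero \<psi>_bound])
  have "\<bar>busy_semigroup s \<psi> x\<bar> \<le> \<bar>exp_series uniformized s \<psi> x\<bar>"
    using assms total_rate_nonneg by (simp add: busy_semigroup_def abs_mult mult_left_le_one_le)
  also have "\<dots> \<le> a * exp (\<bar>s\<bar> * (3 * total_rate))"
    by (rule exp_series_bound[OF uniformized_operator_bound \<psi>_bound])
  also have "\<dots> \<le> a * exp (T * (3 * total_rate))"
    using assms a total_rate_nonneg by (intro mult_left_mono) (auto intro: mult_right_mono)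
  finally show ?thesis .
qed

lemma exp_series_uniformized:
  "exp_series uniformized s (uniformized \<psi>) x = uniformized (exp_series uniformized s \<psi>) x"
proof -
  have "(\<lambda>n. s ^ n / fact n * (uniformized ^^ n) \<psi> x) sums exp_series uniformized s \<psi> x" for x
    by (rule exp_series_sums[OF uniformized_operator_bound \<psi>_bound])
  then have "(\<lambda>n. uniformized (\<lambda>x. s ^ n / fact n * (uniformized ^^ n) \<psi> x) x) sums
      uniformized (exp_series uniformized s \<psi>) x"
    unfolding uniformized_def[of _ x] by (intro sums_add busy_generator_sums sums_mult)
  moreover have "uniformized (\<lambda>x. s ^ n / fact n * (uniformized ^^ n) \<psi> x) x =
      s ^ n / fact n * (uniformized ^^ n) (uniformized \<psi>) x" for n
  proof -
    have "(uniformized ^^ n) (uniformized \<psi>) = uniformized ((uniformized ^^ n) \<psi>)"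
      by (simp add: funpow_swap1)
    then show ?thesis
      by (simp only: uniformized_def[of _ x] busy_generator_scale distrib_left mult.left_commute)
  qed
  ultimately show ?thesis
    by (simp add: exp_series_def sums_iff)
qed

lemma busy_semigroup_has_real_derivative:
  "((\<lambda>s. busy_semigroup s \<psi> x) has_real_derivative busy_generator (busy_semigroup s \<psi>) x) (at s)"
proof -
  have "((\<lambda>s. busy_semigroup s \<psi> x) has_real_derivative
      (- total_rate * exp (- total_rate * s)) * exp_series uniformized s \<psi> x +
      exp_series uniformized s (uniformized \<psi>) x * exp (- total_rate * s)) (at s)"
    unfolding busy_semigroup_def
    by (rule DERIV_mult[OF _ exp_series_has_real_derivative[OF uniformized_operator_bound \<psi>_bound]])
      (auto intro!: derivative_eq_intros)
  moreover have "busy_generator (busy_semigroup s \<psi>) x =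
      exp (- total_rate * s) * busy_generator (exp_series uniformized s \<psi>) x"
    unfolding busy_semigroup_def[abs_def] by (rule busy_generator_scale)
  ultimately show ?thesis
    by (simp add: exp_series_uniformized uniformized_def algebra_simps)
qed

lemma busy_semigroup_balanced:
  assumes "balanced \<psi>"
  shows "balanced (busy_semigroup s \<psi>)"
  unfolding balanced_def
proof (intro allI ballI)
  fix x :: "'k state" and i j :: 'k
  assume ij: "i \<in> nonempty_classes x" "j \<in> nonempty_classes x"
  have "balanced ((uniformized ^^ n) \<psi>)" for n
    by (induction n) (auto intro: assms balanced_uniformized)
  then have eq: "\<mu> $ i * diff_down i ((uniformized ^^ n) \<psi>) x = \<mu> $ j * diff_down j ((uniformized ^^ n) \<psi>) x" for n
    using ij unfolding balanced_def by blast
  have "(\<lambda>n. exp (- total_rate * s) * (s ^ n / fact n) * (\<mu> $ l * diff_down l ((uniformized ^^ n) \<psi>) x))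
      sums (\<mu> $ l * diff_down l (busy_semigroup s \<psi>) x)" for l
    using sums_mult[OF sums_diff[OF busy_semigroup_sums[of s "x - unit_state l"] busy_semigroup_sums[of s x]], of "\<mu> $ l"]
    by (simp add: diff_down_def algebra_simps)
  from this[of i] this[of j] show "\<mu> $ i * diff_down i (busy_semigroup s \<psi>) x =
      \<mu> $ j * diff_down j (busy_semigroup s \<psi>) x"
    unfolding eq by (rule sums_unique2)
qed

lemma busy_semigroup_decreasing:
  assumes "balanced \<psi>" "decreasing \<psi>" "s \<ge> 0"
  shows "decreasing (busy_semigroup s \<psi>)"
  unfolding decreasing_def
proof
  fix x
  have "balanced ((uniformized ^^ n) \<psi>) \<and> decreasing ((uniformized ^^ n) \<psi>)" for n
    by (induction n) (auto intro: assms balanced_uniformized decreasing_uniformized)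
  then have "0 \<le> exp (- total_rate * s) * (s ^ n / fact n) * drain ((uniformized ^^ n) \<psi>) x" for n
    using \<open>s \<ge> 0\<close> by (auto simp: decreasing_def intro!: mult_nonneg_nonneg)
  moreover have "(\<lambda>n. exp (- total_rate * s) * (s ^ n / fact n) * drain ((uniformized ^^ n) \<psi>) x)
      sums drain (busy_semigroup s \<psi>) x"
    using drain_sums[of _ "busy_semigroup s \<psi>" x, OF busy_semigroup_sums] by (simp only: drain_scale)
  ultimately show "0 \<le> drain (busy_semigroup s \<psi>) x"
    by (rule sums_le[OF _ sums_zero])
qed

end

text \<open>
  The Laplace transform at \<open>1\<close> of the total remaining work in state \<open>x\<close>, where a customer of class
  \<open>i\<close> brings an independent exponential amount of rate \<open>\<mu> $ i\<close>.
\<close>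

definition workload_transform :: "'k state \<Rightarrow> real" where
  "workload_transform x = (\<Prod>i\<in>UNIV. (\<mu> $ i / (\<mu> $ i + 1)) ^ (x $ i))"

lemma workload_transform_pos: "workload_transform x > 0"
  unfolding workload_transform_def
  by (intro prod_pos ballI zero_less_power divide_pos_pos \<mu>_pos add_pos_pos zero_less_one)

lemma workload_transform_le_1: "workload_transform x \<le> 1"
  unfolding workload_transform_def
  by (intro prod_le_1 conjI power_le_one) (auto simp: \<mu>_pos less_imp_le add_pos_pos divide_nonneg_pos)

text \<open>
  Removing a customer of class \<open>i\<close> divides the transform by \<open>\<mu> $ i / (\<mu> $ i + 1)\<close>, so its
  relative change is \<open>1 / \<mu> $ i\<close>.
\<close>

lemma workload_transform_service:
  assumes "i \<in> nonempty_classes x"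
  shows "\<mu> $ i * diff_down i workload_transform x = workload_transform x"
proof -
  define r where "r j = \<mu> $ j / (\<mu> $ j + 1)" for j
  have xi: "x $ i > 0"
    using assms by (simp add: nonempty_classes_def)
  have eq: "workload_transform y = r i ^ (y $ i) * (\<Prod>j\<in>UNIV - {i}. r j ^ (y $ j))" for y
    unfolding workload_transform_def r_def[symmetric] by (rule prod.remove) auto
  have "(\<Prod>j\<in>UNIV - {i}. r j ^ ((x - unit_state i) $ j)) = (\<Prod>j\<in>UNIV - {i}. r j ^ (x $ j))"
    by (intro prod.cong) (auto simp: axis_def)
  moreover have "r i ^ (x $ i) = r i * r i ^ ((x - unit_state i) $ i)"
    using xi by (simp add: power_eq_if[of _ "x $ i"])
  ultimately have "workload_transform x = r i * workload_transform (x - unit_state i)"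
    by (simp add: eq)
  then show ?thesis
    using \<mu>_pos[of i] by (simp add: diff_down_def r_def field_simps)
qed

lemma balanced_workload_transform: "balanced workload_transform"
  by (simp add: balanced_def workload_transform_service)

lemma drain_workload_transform:
  "drain workload_transform x = (if x = 0 then 0 else workload_transform x)"
proof (cases "x = 0")
  case False
  then obtain i where "i \<in> nonempty_classes x"
    using nonempty_classes_eq_empty_iff by blast
  then show ?thesis
    using False by (simp add: drain_eq[OF balanced_workload_transform] workload_transform_service)
qed simp

end

section \<open>Soft and hard Hamiltonians\<close>

lemma num_nonempty_pos: "x \<noteq> 0 \<Longrightarrow> num_nonempty x > 0"
  using nonempty_classes_eq_empty_iff[of x] by (simp add: num_nonempty_def card_gt_0_iff)

lemma log_num_nonempty_bounds:
  fixes x :: "'k::finite state"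
  shows "0 \<le> log_num_nonempty x" "log_num_nonempty x \<le> ln (real CARD('k))"
proof -
  have "num_nonempty x \<le> CARD('k)"
    unfolding num_nonempty_def by (rule card_mono) auto
  moreover have "1 \<le> CARD('k)"
    by (simp add: Suc_leI)
  ultimately show "0 \<le> log_num_nonempty x" "log_num_nonempty x \<le> ln (real CARD('k))"
    using num_nonempty_pos[of x] by (auto simp: log_num_nonempty_def Suc_le_eq)
qed

text \<open>
  The normalized sum is a mean of exponentials, hence at most their maximum.
\<close>

lemma soft_H_le:
  assumes eps: "\<epsilon> > 0" and x: "x \<noteq> 0"
    and le: "\<And>i. i \<in> nonempty_classes x \<Longrightarrow> \<mu> $ i * diff_down i \<psi> x \<le> a"
  shows "soft_H \<mu> \<epsilon> \<psi> x \<le> a"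
proof -
  have n: "real (num_nonempty x) > 0"
    using num_nonempty_pos[OF x] by simp
  have "(\<Sum>i\<in>nonempty_classes x. exp (\<mu> $ i * diff_down i \<psi> x / \<epsilon>)) \<le> real (num_nonempty x) * exp (a / \<epsilon>)"
    unfolding num_nonempty_def using le eps by (intro sum_bounded_above) (simp add: divide_right_mono)
  then have "1 / real (num_nonempty x) * (\<Sum>i\<in>nonempty_classes x. exp (\<mu> $ i * diff_down i \<psi> x / \<epsilon>)) \<le> exp (a / \<epsilon>)"
    using n by (simp add: pos_divide_le_eq mult.commute)
  moreover have "0 < (\<Sum>i\<in>nonempty_classes x. exp (\<mu> $ i * diff_down i \<psi> x / \<epsilon>))"
    using x nonempty_classes_eq_empty_iff[of x] by (intro sum_pos) auto
  ultimately have "ln (1 / real (num_nonempty x) * (\<Sum>i\<in>nonempty_classes x. exp (\<mu> $ i * diff_down i \<psi> x / \<epsilon>)))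
      \<le> ln (exp (a / \<epsilon>))"
    using n by (intro ln_mono) auto
  then show ?thesis
    using x eps by (simp add: soft_H_def pos_le_divide_eq mult.commute)
qed

text \<open>
  The sum dominates each of its terms; the normalization by \<open>n\<close> costs \<open>\<epsilon> log n\<close>.
\<close>

lemma soft_H_ge:
  assumes eps: "\<epsilon> > 0" and i: "i \<in> nonempty_classes x"
  shows "\<mu> $ i * diff_down i \<psi> x \<le> soft_H \<mu> \<epsilon> \<psi> x + \<epsilon> * log_num_nonempty x"
proof -
  have x: "x \<noteq> 0"
    using i nonempty_classes_eq_empty_iff by blast
  have n: "real (num_nonempty x) > 0"
    using num_nonempty_pos[OF x] by simp
  let ?S = "\<Sum>i\<in>nonempty_classes x. exp (\<mu> $ i * diff_down i \<psi> x / \<epsilon>)"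
  have S: "exp (\<mu> $ i * diff_down i \<psi> x / \<epsilon>) \<le> ?S"
    using i by (intro member_le_sum) auto
  then have "?S > 0"
    using exp_gt_zero less_le_trans by blast
  with S have "\<mu> $ i * diff_down i \<psi> x / \<epsilon> \<le> ln ?S"
    using ln_ge_iff[OF \<open>?S > 0\<close>] by simp
  moreover have "soft_H \<mu> \<epsilon> \<psi> x + \<epsilon> * log_num_nonempty x = \<epsilon> * ln ?S"
  proof -
    have "ln (1 / real (num_nonempty x) * ?S) = ln ?S - ln (real (num_nonempty x))"
      using n \<open>?S > 0\<close> by (simp add: ln_div)
    then show ?thesis
      using x by (simp add: soft_H_def log_num_nonempty_def right_diff_distrib)
  qed
  ultimately show ?thesis
    using eps by (simp add: pos_divide_le_eq mult.commute)
qed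

context queue
begin

text \<open>The share of effort given to empty classes.\<close>

definition idle_fraction :: "real ^ 'k \<Rightarrow> 'k state \<Rightarrow> real" where
  "idle_fraction u x = 1 - (\<Sum>i\<in>nonempty_classes x. u $ i / \<mu> $ i)"

lemma idle_fraction_bounds:
  assumes u: "u \<in> action_hull \<mu>"
  shows "0 \<le> idle_fraction u x" "idle_fraction u x \<le> 1"
proof -
  have nn: "u $ i / \<mu> $ i \<ge> 0" for i
    using action_hull_weights(1)[OF \<mu>_pos u] \<mu>_pos by (simp add: less_imp_le)
  have "(\<Sum>i\<in>nonempty_classes x. u $ i / \<mu> $ i) \<le> (\<Sum>i\<in>UNIV. u $ i / \<mu> $ i)"
    using nn by (intro sum_mono2) auto
  then show "0 \<le> idle_fraction u x"
    by (simp add: idle_fraction_def action_hull_weights(2)[OF \<mu>_pos u])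
  show "idle_fraction u x \<le> 1"
    using nn by (simp add: idle_fraction_def sum_nonneg)
qed

text \<open>
  Without idling the shares of effort on the nonempty classes sum to \<open>1\<close>, so the service term is an
  average of single-class terms. An idling control would give an average with a zero term, which can
  exceed the maximum over the nonempty classes when that maximum is negative.
\<close>

lemma service_le_soft_H:
  assumes eps: "\<epsilon> > 0" and u: "u \<in> action_hull \<mu>" and busy: "x \<noteq> 0 \<Longrightarrow> idle_fraction u x = 0"
  shows "(\<Sum>i\<in>nonempty_classes x. u $ i * diff_down i \<psi> x) \<le> soft_H \<mu> \<epsilon> \<psi> x + \<epsilon> * log_num_nonempty x"
proof (cases "x = 0")
  case True
  then show ?thesis
    using nonempty_classes_eq_empty_iff[of x] by (simp add: soft_H_def log_num_nonempty_def)
next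
  case False
  let ?R = "soft_H \<mu> \<epsilon> \<psi> x + \<epsilon> * log_num_nonempty x"
  have "(\<Sum>i\<in>nonempty_classes x. u $ i * diff_down i \<psi> x) =
      (\<Sum>i\<in>nonempty_classes x. u $ i / \<mu> $ i * (\<mu> $ i * diff_down i \<psi> x))"
    using \<mu>_pos by (intro sum.cong) (auto simp: less_imp_neq[THEN not_sym])
  also have "\<dots> \<le> (\<Sum>i\<in>nonempty_classes x. u $ i / \<mu> $ i * ?R)"
    using action_hull_weights(1)[OF \<mu>_pos u] \<mu>_pos
    by (intro sum_mono mult_left_mono soft_H_ge[OF eps]) (auto simp: less_imp_le)
  also have "\<dots> = ?R"
    using busy[OF False] unfolding sum_distrib_right[symmetric] by (simp add: idle_fraction_def)
  finally show ?thesis .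
qed

text \<open>
  A balanced perturbation shifts all exponents by the same amount, so the nonlinear Hamiltonian
  responds to it exactly linearly.
\<close>

lemma soft_H_minus_balanced:
  assumes eps: "\<epsilon> > 0" and \<phi>: "balanced \<phi>"
  shows "soft_H \<mu> \<epsilon> (\<lambda>x. \<psi> x - \<phi> x) x = soft_H \<mu> \<epsilon> \<psi> x - drain \<phi> x"
proof (cases "x = 0")
  case False
  let ?S = "\<Sum>i\<in>nonempty_classes x. exp (\<mu> $ i * diff_down i \<psi> x / \<epsilon>)"
  have n: "real (num_nonempty x) > 0"
    using num_nonempty_pos[OF False] by simp
  have S: "?S > 0"
    using False nonempty_classes_eq_empty_iff[of x] by (intro sum_pos) auto
  have "(\<Sum>i\<in>nonempty_classes x. exp (\<mu> $ i * diff_down i (\<lambda>x. \<psi> x - \<phi> x) x / \<epsilon>)) =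
      (\<Sum>i\<in>nonempty_classes x. exp (\<mu> $ i * diff_down i \<psi> x / \<epsilon>) * exp (- drain \<phi> x / \<epsilon>))"
  proof (intro sum.cong refl)
    fix i assume i: "i \<in> nonempty_classes x"
    have "\<mu> $ i * diff_down i (\<lambda>x. \<psi> x - \<phi> x) x = \<mu> $ i * diff_down i \<psi> x - drain \<phi> x"
      unfolding drain_eq[OF \<phi> i] by (simp add: diff_down_def algebra_simps)
    then show "exp (\<mu> $ i * diff_down i (\<lambda>x. \<psi> x - \<phi> x) x / \<epsilon>) =
        exp (\<mu> $ i * diff_down i \<psi> x / \<epsilon>) * exp (- drain \<phi> x / \<epsilon>)"
      by (simp add: exp_add[symmetric] diff_divide_distrib)
  qed
  then have "soft_H \<mu> \<epsilon> (\<lambda>x. \<psi> x - \<phi> x) x =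
      \<epsilon> * ln ((1 / real (num_nonempty x) * ?S) * exp (- drain \<phi> x / \<epsilon>))"
    using False by (simp add: soft_H_def sum_distrib_right)
  also have "\<dots> = \<epsilon> * (ln (1 / real (num_nonempty x) * ?S) + (- drain \<phi> x / \<epsilon>))"
    using S n by (subst ln_mult) auto
  also have "\<dots> = soft_H \<mu> \<epsilon> \<psi> x - drain \<phi> x"
    using False eps by (simp add: soft_H_def right_diff_distrib)
  finally show ?thesis .
qed (simp add: soft_H_def)

lemma soft_Hamiltonian_minus_balanced:
  assumes "\<epsilon> > 0" "balanced \<phi>"
  shows "soft_Hamiltonian lam \<mu> c \<epsilon> (\<lambda>x. \<psi> x - \<phi> x) x =
    soft_Hamiltonian lam \<mu> c \<epsilon> \<psi> x - busy_generator \<phi> x"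
proof -
  have "diff_up i (\<lambda>x. \<psi> x - \<phi> x) x = diff_up i \<psi> x - diff_up i \<phi> x" for i
    by (simp add: diff_up_def)
  then show ?thesis
    by (simp add: soft_Hamiltonian_def busy_generator_def soft_H_minus_balanced[OF assms]
      right_diff_distrib sum_subtractf)
qed

lemma busy_generator_minus_control_generator:
  assumes \<psi>: "balanced \<psi>"
  shows "busy_generator \<psi> x - control_generator lam m \<psi> x = idle_fraction (m x) x * drain \<psi> x"
proof -
  have "(\<Sum>i\<in>nonempty_classes x. m x $ i * diff_down i \<psi> x) =
      (\<Sum>i\<in>nonempty_classes x. m x $ i / \<mu> $ i * drain \<psi> x)"
    using \<mu>_pos by (intro sum.cong) (auto simp: drain_eq[OF \<psi>] less_imp_neq[THEN not_sym])
  then show ?thesis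
    by (simp add: busy_generator_def control_generator_def generator_eq idle_fraction_def
      sum_distrib_right left_diff_distrib)
qed

end

section \<open>The soft-feasible class\<close>

text \<open>A single constant can bound \<open>f\<close> and its time derivative uniformly on the interval.\<close>

lemma soft_feasible_iff:
  assumes V: "\<And>x. V x \<ge> 0"
  shows "f \<in> soft_feasible lam \<mu> c V \<epsilon> T \<longleftrightarrow> (\<exists>f' C.
    (\<forall>x. continuous_on {0..T} (\<lambda>t. f' t x)) \<and>
    (\<forall>x. \<forall>t\<in>{0..T}. ((\<lambda>s. f s x) has_real_derivative f' t x) (at t within {0..T})) \<and>
    (\<forall>t\<in>{0..T}. \<forall>x. \<bar>f t x\<bar> \<le> C * (1 + V x) \<and> \<bar>f' t x\<bar> \<le> C * (1 + V x)) \<and>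
    (\<forall>t\<in>{0..T}. \<forall>x. f' t x + soft_Hamiltonian lam \<mu> c \<epsilon> (f t) x \<le> 0))"
proof -
  have "(SUP t\<in>{0..T}. norm_V V (f t)) + (SUP t\<in>{0..T}. norm_V V (f' t)) < \<infinity> \<longleftrightarrow>
    (\<exists>C. \<forall>t\<in>{0..T}. \<forall>x. \<bar>f t x\<bar> \<le> C * (1 + V x) \<and> \<bar>f' t x\<bar> \<le> C * (1 + V x))" for f'
  proof -
    have "(SUP t\<in>{0..T}. norm_V V (f t)) + (SUP t\<in>{0..T}. norm_V V (f' t)) < \<infinity> \<longleftrightarrow>
        (SUP t\<in>{0..T}. norm_V V (f t)) < \<infinity> \<and> (SUP t\<in>{0..T}. norm_V V (f' t)) < \<infinity>"
      by (simp add: less_top[symmetric])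
    also have "\<dots> \<longleftrightarrow> (\<exists>C. \<forall>t\<in>{0..T}. \<forall>x. \<bar>f t x\<bar> \<le> C * (1 + V x) \<and> \<bar>f' t x\<bar> \<le> C * (1 + V x))"
      (is "?L \<longleftrightarrow> ?R")
    proof
      assume ?L
      then obtain C D where C: "\<forall>t\<in>{0..T}. \<forall>x. \<bar>f t x\<bar> \<le> C * (1 + V x)"
        and D: "\<forall>t\<in>{0..T}. \<forall>x. \<bar>f' t x\<bar> \<le> D * (1 + V x)"
        unfolding SUP_norm_V_finite_iff[OF V] by blast
      have "C * (1 + V x) \<le> max C D * (1 + V x)" "D * (1 + V x) \<le> max C D * (1 + V x)" for x
        using V[of x] by (auto intro!: mult_right_mono)
      with C D have "\<forall>t\<in>{0..T}. \<forall>x. \<bar>f t x\<bar> \<le> max C D * (1 + V x) \<and> \<bar>f' t x\<bar> \<le> max C D * (1 + V x)"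
        by (meson order_trans)
      then show ?R ..
    next
      assume ?R
      then obtain C where C: "\<forall>t\<in>{0..T}. \<forall>x. \<bar>f t x\<bar> \<le> C * (1 + V x) \<and> \<bar>f' t x\<bar> \<le> C * (1 + V x)" ..
      have "C * (1 + V x) \<le> \<bar>C\<bar> * (1 + V x)" for x
        using V[of x] by (auto intro!: mult_right_mono)
      with C have "\<forall>t\<in>{0..T}. \<forall>x. \<bar>f t x\<bar> \<le> \<bar>C\<bar> * (1 + V x) \<and> \<bar>f' t x\<bar> \<le> \<bar>C\<bar> * (1 + V x)"
        by (meson order_trans)
      then show ?L
        unfolding SUP_norm_V_finite_iff[OF V] by (intro conjI exI[of _ "\<bar>C\<bar>"]) auto
    qed
    finally show ?thesis .
  qed
  then show ?thesis
    by (simp add: soft_feasible_def) blast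
qed

text \<open>
  The perturbation solves the backward equation, so its time derivative cancels the shift of the
  soft Hamiltonian and the left-hand side of the constraint is unchanged.
\<close>

lemma (in queue) soft_feasible_minus_busy_semigroup:
  assumes V: "\<And>x. V x \<ge> 0" and eps: "\<epsilon> > 0" and f: "f \<in> soft_feasible lam \<mu> c V \<epsilon> T"
    and \<psi>: "\<And>x. \<bar>\<psi> x\<bar> \<le> a" "balanced \<psi>"
  shows "(\<lambda>t x. f t x - busy_semigroup (T - t) \<psi> x) \<in> soft_feasible lam \<mu> c V \<epsilon> T"
proof -
  obtain f' C where cont: "\<And>x. continuous_on {0..T} (\<lambda>t. f' t x)"
    and der: "\<And>t x. t \<in> {0..T} \<Longrightarrow> ((\<lambda>s. f s x) has_real_derivative f' t x) (at t within {0..T})"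
    and bound: "\<And>t x. t \<in> {0..T} \<Longrightarrow> \<bar>f t x\<bar> \<le> C * (1 + V x)" "\<And>t x. t \<in> {0..T} \<Longrightarrow> \<bar>f' t x\<bar> \<le> C * (1 + V x)"
    and sub: "\<And>t x. t \<in> {0..T} \<Longrightarrow> f' t x + soft_Hamiltonian lam \<mu> c \<epsilon> (f t) x \<le> 0"
    using f unfolding soft_feasible_iff[OF V] by blast
  define \<phi> where "\<phi> s = busy_semigroup s \<psi>" for s
  define D where "D = a * exp (T * (3 * total_rate))"
  have \<phi>: "\<bar>\<phi> (T - t) x\<bar> \<le> D" if "t \<in> {0..T}" for t x
    unfolding \<phi>_def D_def using that by (intro busy_semigroup_bound[OF \<psi>(1)]) auto
  have B\<phi>: "\<bar>busy_generator (\<phi> (T - t)) x\<bar> \<le> 2 * total_rate * D" if "t \<in> {0..T}" for t x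
    using \<phi>[OF that] by (rule busy_generator_bound)
  have \<phi>_der: "((\<lambda>t. \<phi> (T - t) x) has_real_derivative - busy_generator (\<phi> (T - t)) x) (at t)" for t x
  proof -
    have "((\<lambda>t. T - t) has_real_derivative - 1) (at t)"
      by (auto intro!: derivative_eq_intros)
    from DERIV_chain2[OF busy_semigroup_has_real_derivative[OF \<psi>(1)] this] show ?thesis
      by (simp add: \<phi>_def)
  qed
  have \<phi>_cont: "continuous_on {0..T} (\<lambda>t. \<phi> (T - t) x)" for x
    using \<phi>_der by (intro DERIV_continuous_on[OF has_field_derivative_at_within]) auto
  have B\<phi>_cont: "continuous_on {0..T} (\<lambda>t. busy_generator (\<phi> (T - t)) x)" for x
    unfolding busy_generator_def drain_def diff_up_def diff_down_def Let_def
    by (cases "x = 0") (auto intro!: continuous_intros \<phi>_cont)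
  define f2 where "f2 t x = f' t x + busy_generator (\<phi> (T - t)) x" for t x
  show ?thesis
    unfolding soft_feasible_iff[OF V] \<phi>_def[symmetric]
  proof (intro exI conjI allI ballI)
    fix x show "continuous_on {0..T} (\<lambda>t. f2 t x)"
      unfolding f2_def by (intro continuous_intros cont B\<phi>_cont)
  next
    fix x t assume t: "t \<in> {0..T}"
    show "((\<lambda>s. f s x - \<phi> (T - s) x) has_real_derivative f2 t x) (at t within {0..T})"
      using DERIV_diff[OF der[OF t, of x] has_field_derivative_at_within[OF \<phi>_der[of x t]]]
      by (simp add: f2_def)
    have "D \<ge> 0"
      by (rule order_trans[OF abs_ge_zero \<phi>[OF t]])
    let ?C = "C + D + 2 * total_rate * D"
    have nn: "0 \<le> D * V x" "0 \<le> total_rate * D * V x" "0 \<le> total_rate * D"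
      using \<open>D \<ge> 0\<close> total_rate_nonneg V[of x] by auto
    have C: "C * (1 + V x) + D \<le> ?C * (1 + V x)" "C * (1 + V x) + 2 * total_rate * D \<le> ?C * (1 + V x)"
      using nn \<open>D \<ge> 0\<close> by (simp_all add: algebra_simps)
    show "\<bar>f t x - \<phi> (T - t) x\<bar> \<le> ?C * (1 + V x)"
      using bound(1)[OF t, of x] \<phi>[OF t, of x] C(1) by linarith
    show "\<bar>f2 t x\<bar> \<le> ?C * (1 + V x)"
      unfolding f2_def using bound(2)[OF t, of x] B\<phi>[OF t, of x] C(2) by linarith
    have "balanced (\<phi> (T - t))"
      unfolding \<phi>_def by (rule busy_semigroup_balanced[OF \<psi>])
    then show "f2 t x + soft_Hamiltonian lam \<mu> c \<epsilon> (\<lambda>x. f t x - \<phi> (T - t) x) x \<le> 0"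
      using sub[OF t, of x] by (simp add: f2_def soft_Hamiltonian_minus_balanced[OF eps])
  qed
qed

section \<open>Comparison with the ergodic optimality equation\<close>

context stationary_queue
begin

text \<open>
  Let \<open>\<phi> s\<close> be the work-conserving evolution of the workload transform. Subtracting \<open>\<phi> (T - t)\<close> from the
  optimal \<open>f\<close> changes the pairing by the increment of the expectation \<open>e\<close> of \<open>\<phi>\<close>
  over \<open>{0..T}\<close>, which is therefore at most \<open>0\<close>. Since \<open>p\<close> annihilates the generator of \<open>m\<close>, the derivative of \<open>e\<close> is
  the expectation of the idle fraction times \<open>drain (\<phi> s)\<close>, which is nonnegative. So it vanishes at
  time \<open>0\<close>, where \<open>drain\<close> is positive at every nonempty state.
\<close>

lemma attained_supremum_imp_no_idling:
  assumes T: "T > 0" and eps: "\<epsilon> > 0"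
    and f: "is_arg_max (increment_pairing p T) (\<lambda>f. f \<in> soft_feasible lam \<mu> c V \<epsilon> T) f"
    and x: "x \<in> set_pmf p" "x \<noteq> 0"
  shows "idle_fraction (m x) x = 0"
proof -
  define \<theta> where "\<theta> = workload_transform"
  define \<phi> where "\<phi> s = busy_semigroup s \<theta>" for s
  define e where "e s = measure_pmf.expectation p (\<phi> s)" for s
  define e' where "e' s = measure_pmf.expectation p (\<lambda>x. idle_fraction (m x) x * drain (\<phi> s) x)" for s
  have \<theta>: "\<bar>\<theta> x\<bar> \<le> 1" "balanced \<theta>" "decreasing \<theta>" for x
    using workload_transform_pos[of x] workload_transform_le_1[of x] balanced_workload_transform
    by (auto simp: \<theta>_def decreasing_def drain_workload_transform less_imp_le[OF workload_transform_pos])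
  define D where "D = 1 * exp (T * (3 * total_rate))"
  have \<phi>_bound: "\<bar>\<phi> s x\<bar> \<le> D" if "s \<in> {0..T}" for s x
    unfolding \<phi>_def D_def using that by (intro busy_semigroup_bound[OF \<theta>(1)]) auto
  have \<phi>_bal: "balanced (\<phi> s)" for s
    unfolding \<phi>_def by (rule busy_semigroup_balanced[OF \<theta>(1,2)])
  have \<phi>_int: "integrable (measure_pmf p) (\<phi> s)" if "s \<in> {0..T}" for s
    using \<phi>_bound[OF that] by (intro measure_pmf.integrable_const_bound[where B=D]) auto
  have B\<phi>_bound: "\<bar>busy_generator (\<phi> s) x\<bar> \<le> 2 * total_rate * D" if "s \<in> {0..T}" for s x
    using \<phi>_bound[OF that] by (rule busy_generator_bound)
  have idle_int: "integrable (measure_pmf p) (\<lambda>x. idle_fraction (m x) x * drain (\<phi> s) x)"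
    and e'_eq: "measure_pmf.expectation p (busy_generator (\<phi> s)) = e' s" if s: "s \<in> {0..T}" for s
  proof -
    have dom: "dominated V (\<phi> s)"
      using V(1) \<phi>_bound[OF s] by (rule dominated_bounded)
    have B: "integrable (measure_pmf p) (busy_generator (\<phi> s))"
      using B\<phi>_bound[OF s] by (intro measure_pmf.integrable_const_bound[where B="2 * total_rate * D"]) auto
    have G: "integrable (measure_pmf p) (control_generator lam m (\<phi> s))"
      by (rule dominated_integrable[OF int invariant_distribution_dominated(1)[OF dom]])
    show "integrable (measure_pmf p) (\<lambda>x. idle_fraction (m x) x * drain (\<phi> s) x)"
      using Bochner_Integration.integrable_diff[OF B G]
      by (simp only: busy_generator_minus_control_generator[OF \<phi>_bal])
    show "measure_pmf.expectation p (busy_generator (\<phi> s)) = e' s"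
      using Bochner_Integration.integral_diff[OF B G] invariant_distribution_dominated(2)[OF dom]
      by (simp only: busy_generator_minus_control_generator[OF \<phi>_bal] e'_def diff_zero)
  qed
  have e_der: "(e has_real_derivative e' s) (at s within {0..T})" if s: "s \<in> {0..T}" for s
    unfolding e_def[abs_def] e'_eq[OF s, symmetric]
  proof (rule expectation_has_real_derivative[where w="\<lambda>_. 2 * total_rate * D" and F=\<phi>])
    show "((\<lambda>s. \<phi> s x) has_real_derivative busy_generator (\<phi> t) x) (at t within {0..T})" for t x
      unfolding \<phi>_def
      by (rule has_field_derivative_at_within[OF busy_semigroup_has_real_derivative[OF \<theta>(1)]])
  qed (use B\<phi>_bound \<phi>_int s in auto)
  have e'_nonneg: "e' s \<ge> 0" if "s \<in> {0..T}" for s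
    unfolding e'_def
  proof (rule Bochner_Integration.integral_nonneg)
    fix x
    have "decreasing (\<phi> s)"
      unfolding \<phi>_def using that by (intro busy_semigroup_decreasing[OF \<theta>(1) \<theta>(2,3)]) auto
    then show "0 \<le> idle_fraction (m x) x * drain (\<phi> s) x"
      using idle_fraction_bounds(1)[OF m] by (simp add: decreasing_def)
  qed
  have mono: "e s \<le> e T" if s: "s \<in> {0..T}" for s
  proof (rule DERIV_nonneg_imp_increasing_open[where f=e])
    show "\<exists>y. (e has_real_derivative y) (at r) \<and> 0 \<le> y" if "s < r" "r < T" for r
    proof -
      have "at r within {0..T} = at r"
        using s that by (intro at_within_interior) auto
      then show ?thesis
        using e_der[of r] e'_nonneg[of r] s that by auto
    qed
    show "continuous_on {s..T} e"
      using DERIV_continuous_on[OF e_der] by (rule continuous_on_subset) (use s in auto)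
  qed (use s in auto)
  have "e T \<le> e 0"
  proof -
    have f_feas: "f \<in> soft_feasible lam \<mu> c V \<epsilon> T"
      using f by (simp add: is_arg_max_def)
    have "\<not> increment_pairing p T (\<lambda>t x. f t x - \<phi> (T - t) x) > increment_pairing p T f"
      using f soft_feasible_minus_busy_semigroup[OF V(1) eps f_feas \<theta>(1,2)]
      unfolding is_arg_max_def \<phi>_def by blast
    moreover have "increment_pairing p T (\<lambda>t x. f t x - \<phi> (T - t) x) = increment_pairing p T f + (e T - e 0)"
    proof -
      obtain C where C: "\<And>t x. t \<in> {0..T} \<Longrightarrow> \<bar>f t x\<bar> \<le> C * (1 + V x)"
        using f_feas unfolding soft_feasible_iff[OF V(1)] by blast
      have "integrable (measure_pmf p) (f t)" if "t \<in> {0..T}" for t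
        by (rule dominated_integrable[OF int dominatedI[OF C[OF that]]])
      from this[of T] this[of 0] \<phi>_int[of T] \<phi>_int[of 0] T show ?thesis
        by (simp add: increment_pairing_def e_def)
    qed
    ultimately show ?thesis
      by simp
  qed
  moreover have "e' 0 \<le> 0"
  proof (rule ccontr)
    assume "\<not> e' 0 \<le> 0"
    then obtain d where d: "d > 0" "\<And>h. h > 0 \<Longrightarrow> 0 + h \<in> {0..T} \<Longrightarrow> h < d \<Longrightarrow> e 0 < e (0 + h)"
      using has_real_derivative_pos_inc_right[OF e_der[of 0]] T by auto
    have "e 0 < e (min T (d / 2))"
      using d(2)[of "min T (d / 2)"] d(1) T by auto
    also have "\<dots> \<le> e T"
      using d(1) T by (intro mono) auto
    finally show False
      using \<open>e T \<le> e 0\<close> by simp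
  qed
  ultimately have "e' 0 = 0"
    using e'_nonneg[of 0] T by simp
  moreover have \<phi>_0: "\<phi> 0 = \<theta>"
    by (simp add: \<phi>_def busy_semigroup_0)
  ultimately have "AE x in measure_pmf p. idle_fraction (m x) x * drain \<theta> x = 0"
    using idle_int[of 0] T idle_fraction_bounds(1)[OF m] \<theta>(3)
    by (subst integral_nonneg_eq_0_iff_AE[symmetric]) (auto simp: e'_def decreasing_def)
  then have "idle_fraction (m x) x * drain \<theta> x = 0"
    using x(1) by (simp add: AE_measure_pmf_iff)
  then show ?thesis
    using x(2) workload_transform_pos[of x] by (simp add: \<theta>_def drain_workload_transform)
qed

text \<open>
  By the mean value theorem the increment is \<open>T\<close> times the expectation of the time derivative
  at some time. Feasibility and \<open>service_le_soft_H\<close> bound this derivative, and the generator term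
  has expectation \<open>0\<close>.
\<close>

lemma soft_increment_le:
  assumes T: "T > 0" and eps: "\<epsilon> > 0" and f: "f \<in> soft_feasible lam \<mu> c V \<epsilon> T"
    and busy: "\<And>x. x \<in> set_pmf p \<Longrightarrow> x \<noteq> 0 \<Longrightarrow> idle_fraction (m x) x = 0"
    and c: "integrable (measure_pmf p) c"
  shows "increment_pairing p T f \<le>
    T * (measure_pmf.expectation p c + \<epsilon> * measure_pmf.expectation p log_num_nonempty)"
proof -
  obtain f' C where der: "\<And>t x. t \<in> {0..T} \<Longrightarrow> ((\<lambda>s. f s x) has_real_derivative f' t x) (at t within {0..T})"
    and bound: "\<And>t x. t \<in> {0..T} \<Longrightarrow> \<bar>f t x\<bar> \<le> C * (1 + V x)" "\<And>t x. t \<in> {0..T} \<Longrightarrow> \<bar>f' t x\<bar> \<le> C * (1 + V x)"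
    and sub: "\<And>t x. t \<in> {0..T} \<Longrightarrow> f' t x + soft_Hamiltonian lam \<mu> c \<epsilon> (f t) x \<le> 0"
    using f unfolding soft_feasible_iff[OF V(1)] by blast
  define e where "e t = measure_pmf.expectation p (f t)" for t
  define e' where "e' t = measure_pmf.expectation p (f' t)" for t
  have f_int: "integrable (measure_pmf p) (f t)" if "t \<in> {0..T}" for t
    by (rule dominated_integrable[OF int dominatedI[OF bound(1)[OF that]]])
  have log_int: "integrable (measure_pmf p) log_num_nonempty"
    using log_num_nonempty_bounds[where 'k='k]
    by (intro measure_pmf.integrable_const_bound[where B="ln (real CARD('k))"]) auto
  have e_der: "(e has_real_derivative e' t) (at t within {0..T})" if "t \<in> {0..T}" for t
    unfolding e_def[abs_def] e'_def
    by (rule expectation_has_real_derivative[where w="\<lambda>x. C * (1 + V x)"])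
      (use der bound f_int int that in auto)
  have "\<exists>t\<in>{0<..<T}. e T - e 0 = (*) (e' t) (T - 0)"
    using T e_der by (intro mvt_simple) (auto simp: has_field_derivative_def)
  then obtain t where "t \<in> {0<..<T}" and mvt: "e T - e 0 = e' t * T"
    by auto
  then have t: "t \<in> {0..T}"
    by simp
  \<comment> \<open>The generator of \<open>m\<close> is inserted because its expectation is \<open>0\<close>.\<close>
  have "e' t \<le> measure_pmf.expectation p (\<lambda>x. c x + \<epsilon> * log_num_nonempty x - control_generator lam m (f t) x)"
    unfolding e'_def
  proof (rule integral_mono_AE)
    have dom: "dominated V (f t)"
      by (rule dominatedI[OF bound(1)[OF t]])
    show "integrable (measure_pmf p) (\<lambda>x. c x + \<epsilon> * log_num_nonempty x - control_generator lam m (f t) x)"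
      using c log_int dominated_integrable[OF int invariant_distribution_dominated(1)[OF dom]] by simp
    show "integrable (measure_pmf p) (f' t)"
      by (rule dominated_integrable[OF int dominatedI[OF bound(2)[OF t]]])
    have "f' t x \<le> c x + \<epsilon> * log_num_nonempty x - control_generator lam m (f t) x" if "x \<in> set_pmf p" for x
      using sub[OF t, of x] service_le_soft_H[OF eps m busy[OF that], of "f t"]
      by (simp add: soft_Hamiltonian_def control_generator_def generator_eq)
    then show "AE x in measure_pmf p. f' t x \<le> c x + \<epsilon> * log_num_nonempty x - control_generator lam m (f t) x"
      by (simp add: AE_measure_pmf_iff)
  qed
  also have "\<dots> = measure_pmf.expectation p c + \<epsilon> * measure_pmf.expectation p log_num_nonempty"
  proof -
    have dom: "dominated V (f t)"
      by (rule dominatedI[OF bound(1)[OF t]])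
    show ?thesis
      using c log_int dominated_integrable[OF int invariant_distribution_dominated(1)[OF dom]]
        invariant_distribution_dominated(2)[OF dom]
      by simp
  qed
  finally have "e' t * T \<le> T * (measure_pmf.expectation p c + \<epsilon> * measure_pmf.expectation p log_num_nonempty)"
    using T by (simp add: mult.commute)
  moreover have "increment_pairing p T f = e T - e 0"
    using f_int[of T] f_int[of 0] T by (simp add: increment_pairing_def e_def)
  ultimately show ?thesis
    using mvt by simp
qed

lemma expectation_cost:
  assumes h: "dominated V h" and opt: "\<And>x. g + control_generator lam m h x = c x"
  shows "integrable (measure_pmf p) c" "measure_pmf.expectation p c = g"
proof -
  have "c = (\<lambda>x. g + control_generator lam m h x)"
    using opt by auto
  then show "integrable (measure_pmf p) c" "measure_pmf.expectation p c = g"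
    using dominated_integrable[OF int invariant_distribution_dominated(1)[OF h]]
      invariant_distribution_dominated(2)[OF h] by simp_all
qed

end

text \<open>
  The pure schedules of the nonempty classes compete in the maximum defining \<open>m\<close>, so \<open>h\<close> and \<open>g\<close>
  satisfy the optimality equation with the hard Hamiltonian as an inequality; the soft Hamiltonian
  is smaller still.
\<close>

lemma (in queue) affine_soft_feasible:
  assumes V: "\<And>x. V x \<ge> 0" and eps: "\<epsilon> > 0" and h: "dominated V h"
    and m: "\<And>x u. u \<in> action_hull \<mu> \<Longrightarrow> generator lam u h x \<le> control_generator lam m h x"
    and opt: "\<And>x. g + control_generator lam m h x = c x"
  shows "(\<lambda>t x. h x + g * t) \<in> soft_feasible lam \<mu> c V \<epsilon> T"
proof -
  obtain C where C: "\<And>x. \<bar>h x\<bar> \<le> C * (1 + V x)"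
    using h by (auto simp: dominated_def)
  show ?thesis
    unfolding soft_feasible_iff[OF V]
  proof (intro exI conjI allI ballI)
    fix x show "continuous_on {0..T} (\<lambda>t. (\<lambda>_ _. g) t x)"
      by simp
  next
    fix x t assume t: "t \<in> {0..T}"
    show "((\<lambda>s. h x + g * s) has_real_derivative (\<lambda>_ _. g) t x) (at t within {0..T})"
      by (auto intro!: derivative_eq_intros)
    have C0: "0 \<le> C * (1 + V x)"
      by (rule order_trans[OF abs_ge_zero C])
    have gV: "\<bar>g\<bar> \<le> \<bar>g\<bar> * (1 + V x)" "\<bar>g\<bar> * T \<le> \<bar>g\<bar> * T * (1 + V x)"
      using V[of x] t by (auto simp: mult_left_mono distrib_left)
    let ?C = "C + \<bar>g\<bar> * T + \<bar>g\<bar>"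
    have eq: "?C * (1 + V x) = C * (1 + V x) + \<bar>g\<bar> * T * (1 + V x) + \<bar>g\<bar> * (1 + V x)"
      by (simp add: algebra_simps)
    have "\<bar>g * t\<bar> \<le> \<bar>g\<bar> * T"
      using t by (simp add: abs_mult mult_left_mono)
    then show "\<bar>h x + g * t\<bar> \<le> ?C * (1 + V x)"
      unfolding eq using C[of x] gV by linarith
    have "0 \<le> \<bar>g\<bar> * T"
      using t by simp
    then show "\<bar>(\<lambda>_ _. g) t x\<bar> \<le> ?C * (1 + V x)"
      unfolding eq using C0 gV by linarith
    have "soft_H \<mu> \<epsilon> (\<lambda>x. h x + g * t) x \<le> c x - g - (\<Sum>i\<in>UNIV. lam $ i * diff_up i h x)"
    proof (cases "x = 0")
      case True
      then show ?thesis
        using opt[of x] nonempty_classes_eq_empty_iff[of x]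
        by (simp add: soft_H_def control_generator_def generator_eq)
    next
      case False
      show ?thesis
      proof (rule soft_H_le[OF eps False])
        fix i assume i: "i \<in> nonempty_classes x"
        have "(\<Sum>j\<in>nonempty_classes x. axis i (\<mu> $ i) $ j * diff_down j h x) =
            (\<Sum>j\<in>nonempty_classes x. if j = i then \<mu> $ i * diff_down i h x else 0)"
          by (intro sum.cong) (auto simp: axis_def)
        then have "generator lam (axis i (\<mu> $ i)) h x =
            (\<Sum>j\<in>UNIV. lam $ j * diff_up j h x) + \<mu> $ i * diff_down i h x"
          using i by (simp add: generator_eq)
        moreover have "diff_down i (\<lambda>x. h x + g * t) x = diff_down i h x"
          by (simp add: diff_down_def)
        ultimately show "\<mu> $ i * diff_down i (\<lambda>x. h x + g * t) x \<le>
            c x - g - (\<Sum>i\<in>UNIV. lam $ i * diff_up i h x)"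
          using m[OF pure_schedule_in_action_hull, of i x] opt[of x] by simp
      qed
    qed
    then show "(\<lambda>_ _. g) t x + soft_Hamiltonian lam \<mu> c \<epsilon> (\<lambda>x. h x + g * t) x \<le> 0"
      by (simp add: soft_Hamiltonian_def diff_up_def)
  qed
qed

theorem theorem6p2:
  fixes lam \<mu> :: "real ^ 'k::finite"
    and c V W h :: "'k state \<Rightarrow> real"
    and admissible :: "('k state \<Rightarrow> real ^ 'k) set"
    and C :: "'k state set"
    and u_opt :: "'k state \<Rightarrow> real ^ 'k"
    and p :: "'k state pmf"
    and b \<kappa> g \<epsilon> T :: real
    and f :: "real \<Rightarrow> 'k state \<Rightarrow> real"
  assumes rates: "\<And>i. lam $ i \<ge> 0" "\<And>i. \<mu> $ i > 0"
    and load: "(\<Sum>i\<in>UNIV. lam $ i / \<mu> $ i) < 1"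
    \<comment> \<open>standing stability assumption\<close>
    and V: "\<And>x. V x \<ge> 0" "\<And>a. finite {x. V x \<le> a}"
    and W: "\<And>x. W x \<ge> 1"
    and C: "finite C"
    and admissible_valued: "\<And>m x. m \<in> admissible \<Longrightarrow> m x \<in> action_hull \<mu>"
    and admissible_irreducible:
      "\<And>m. m \<in> admissible \<Longrightarrow> irreducible_process (control_generator lam m)"
    and admissible_drift:
      "\<And>m x. m \<in> admissible \<Longrightarrow> control_generator lam m V x \<le> - W x + b * indicator C x"
    and cost: "\<And>x. 0 \<le> c x" "\<And>x. c x \<le> W x"
    \<comment> \<open>hypothesis (1)\<close>
    and growth: "\<And>x u. u \<in> action_hull \<mu> \<Longrightarrow>
        (\<Sum>i\<in>UNIV. lam $ i * (1 + V (x + unit_state i))) +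
        (\<Sum>i | x $ i > 0. u $ i * (1 + V (x - unit_state i))) \<le> \<kappa> * (1 + V x)"
    \<comment> \<open>hypothesis (2)\<close>
    and h_norm: "norm_V V h < \<infinity>"
    and u_opt: "\<And>x. is_arg_max (\<lambda>u. generator lam u h x - c x) (\<lambda>u. u \<in> action_hull \<mu>) (u_opt x)"
    and optimality_equation: "\<And>x. g + control_generator lam u_opt h x = c x"
    \<comment> \<open>hypothesis (3)\<close>
    and c_coercive: "filterlim c at_top (filtercomap (\<lambda>x. \<Sum>i\<in>UNIV. x $ i) at_top)"
    and h_coercive: "bdd_below (range (\<lambda>x. - h x))" "\<And>a. finite {x. - h x \<le> a}"
    and u_opt_irreducible: "irreducible_process (control_generator lam u_opt)"
    and invariant: "invariant_distribution (control_generator lam u_opt) p"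
    and V_integrable: "integrable (measure_pmf p) V"
    and eps: "\<epsilon> > 0"
    and T: "T > 0"
    and f_optimal:
      "is_arg_max (increment_pairing p T) (\<lambda>f. f \<in> soft_feasible lam \<mu> c V \<epsilon> T) f"
  shows "0 \<le> increment_pairing p T f - g * T \<and>
    increment_pairing p T f - g * T \<le> T * \<epsilon> * measure_pmf.expectation p log_num_nonempty \<and>
    T * \<epsilon> * measure_pmf.expectation p log_num_nonempty \<le> T * \<epsilon> * ln (real CARD('k))"
proof -
  interpret stationary_queue lam \<mu> u_opt V \<kappa> p
  proof
    show "u_opt x \<in> action_hull \<mu>" for x
      using u_opt[of x] by (simp add: is_arg_max_def)
    then show "(\<Sum>i\<in>UNIV. lam $ i * (1 + V (x + unit_state i))) +
        (\<Sum>i | x $ i > 0. u_opt x $ i * (1 + V (x - unit_state i))) \<le> \<kappa> * (1 + V x)" for x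
      by (rule growth)
  qed (use rates V invariant V_integrable in auto)
  have h: "dominated V h"
    using h_norm dominated_iff_norm_V[of V h] V(1) by blast
  have f: "f \<in> soft_feasible lam \<mu> c V \<epsilon> T"
    using f_optimal by (simp add: is_arg_max_def)
  have "generator lam u h x \<le> control_generator lam u_opt h x" if "u \<in> action_hull \<mu>" for x u
    using u_opt[of x] that unfolding is_arg_max_def control_generator_def by force
  then have "(\<lambda>t x. h x + g * t) \<in> soft_feasible lam \<mu> c V \<epsilon> T"
    by (intro affine_soft_feasible[OF V(1) eps h _ optimality_equation])
  then have "\<not> increment_pairing p T (\<lambda>t x. h x + g * t) > increment_pairing p T f"
    using f_optimal unfolding is_arg_max_def by blast
  then have lower: "g * T \<le> increment_pairing p T f"
    by (simp add: increment_pairing_def)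
  note cost_facts = expectation_cost[OF h optimality_equation]
  have "increment_pairing p T f \<le> T * (g + \<epsilon> * measure_pmf.expectation p log_num_nonempty)"
    using soft_increment_le[OF T eps f attained_supremum_imp_no_idling[OF T eps f_optimal] cost_facts(1)]
    by (simp add: cost_facts(2))
  then have upper: "increment_pairing p T f - g * T \<le> T * \<epsilon> * measure_pmf.expectation p log_num_nonempty"
    by (simp add: algebra_simps)
  have "measure_pmf.expectation p log_num_nonempty \<le> ln (real CARD('k))"
    using log_num_nonempty_bounds[where 'k='k]
    by (intro measure_pmf.integral_le_const measure_pmf.integrable_const_bound[where B="ln (real CARD('k))"]) auto
  then have "T * \<epsilon> * measure_pmf.expectation p log_num_nonempty \<le> T * \<epsilon> * ln (real CARD('k))"
    using T eps by (intro mult_left_mono) auto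
  with lower upper show ?thesis
    by simp
qed

end
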